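(* Given $K,L,M,N\in\{0,1,2,\ldots,+\infty\}$, there exist weights $m,n\in C[T_1,T_2]$, which both change sign in $]T_1,T_2[$, such that - the total number of nonempty sets $C_k^{>++}$ and $C_k^{<++}$ with $k\ge2$ is equal to $2K+1$; - the total number of nonempty sets $C_k^{>--}$ and $C_k^{<--}$ with $k\ge2$ is equal to $2L+1$; - the total number of nonempty sets $C_k^{>+-}$ and $C_k^{<+-}$ with $k\ge2$ is equal to $2M+1$; - the total number of nonempty sets $C_k^{>-+}$ and $C_k^{<-+}$ with $k\ge2$ is equal to $2N+1$.
   Context: Let $T_1<T_2$ be reals and let $p,q\in C[T_1,T_2]$ be real-valued with $p>0$, $q\ge 0$ on $[T_1,T_2]$. For real-valued $m,n\in C[T_1,T_2]$, $m\not\equiv0$, $n\not\equiv 0$, and $(a,b)\in\mathbb{R}^2$ consider the problem $$(P)\qquad -(p(t)u')'+q(t)u=a\,m(t)u^{+}-b\,n(t)u^{-}\ \text{in } ]T_1,T_2[,\qquad u(T_1)=u(T_2)=0,$$ where $u^{\pm}:=\max\{\pm u,0\}$, solutions being functions $u\in C^1[T_1,T_2]$ with $pu'\in C^1[T_1,T_2]$. For $k\ge 1$, $C_k^{>}$ (resp. $C_k^{<}$) is the set of $(a,b)\in\mathbb{R}^2$ such that $(P)$ has a solution $u$ with exactly $k-1$ zeros in $]T_1,T_2[$ and $u'(T_1)>0$ (resp. $u'(T_1)<0$). With $\mathbb{R}^{+}=]0,+\infty[$, $\mathbb{R}^{-}=]-\infty,0[$, the additional superscripts $++$, $--$, $+-$,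 $-+$ denote intersection with $\mathbb{R}^{+}\times\mathbb{R}^{+}$, $\mathbb{R}^{-}\times\mathbb{R}^{-}$, $\mathbb{R}^{+}\times\mathbb{R}^{-}$, $\mathbb{R}^{-}\times\mathbb{R}^{+}$ respectively (e.g. $C_k^{<-+}:=C_k^{<}\cap(\mathbb{R}^{-}\times\mathbb{R}^{+})$). When counting nonempty sets, $C_k^{>\cdot\cdot}$ and $C_k^{<\cdot\cdot}$ are counted separately even if they coincide, and $2\cdot(+\infty)+1=+\infty$. A function $m$ changes sign in $]T_1,T_2[$ if both $m^{+}\not\equiv0$ and $m^{-}\not\equiv0$ there. *)

theory Defs
  imports "HOL-Analysis.Analysis" "HOL-Library.Extended_Nat"
begin

(* Functions on [T1, T2] are total functions real => real of which only the values on {T1..T2}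
   matter.  Derivatives are taken within {T1..T2}, so they are one-sided at the end points; the
   function u' is then uniquely determined on {T1..T2} by u.  The function w is (p u')'. *)

definition is_solution ::
  "real \<Rightarrow> real \<Rightarrow> (real \<Rightarrow> real) \<Rightarrow> (real \<Rightarrow> real) \<Rightarrow> (real \<Rightarrow> real) \<Rightarrow> (real \<Rightarrow> real) \<Rightarrow>
    real \<Rightarrow> real \<Rightarrow> (real \<Rightarrow> real) \<Rightarrow> (real \<Rightarrow> real) \<Rightarrow> bool" where
  "is_solution T1 T2 p q m n a b u u' \<longleftrightarrow>
     (\<forall>t\<in>{T1..T2}. (u has_real_derivative u' t) (at t within {T1..T2})) \<and>
     continuous_on {T1..T2} u' \<and>
     (\<exists>w. (\<forall>t\<in>{T1..T2}. ((\<lambda>s. p s * u' s) has_real_derivative w t) (at t within {T1..T2})) \<and>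
          continuous_on {T1..T2} w \<and>
          (\<forall>t\<in>{T1<..<T2}.
             - w t + q t * u t = a * m t * max (u t) 0 - b * n t * max (- u t) 0)) \<and>
     u T1 = 0 \<and> u T2 = 0"

(* Finiteness is stated separately because card is 0 on infinite sets. *)

definition has_zeros :: "real \<Rightarrow> real \<Rightarrow> (real \<Rightarrow> real) \<Rightarrow> nat \<Rightarrow> bool" where
  "has_zeros T1 T2 u j \<longleftrightarrow>
     finite {t \<in> {T1<..<T2}. u t = 0} \<and> card {t \<in> {T1<..<T2}. u t = 0} = j"

definition C_gt ::
  "real \<Rightarrow> real \<Rightarrow> (real \<Rightarrow> real) \<Rightarrow> (real \<Rightarrow> real) \<Rightarrow> (real \<Rightarrow> real) \<Rightarrow> (real \<Rightarrow> real) \<Rightarrow>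
    nat \<Rightarrow> (real \<times> real) set" where
  "C_gt T1 T2 p q m n k =
     {(a, b). \<exists>u u'. is_solution T1 T2 p q m n a b u u' \<and> has_zeros T1 T2 u (k - 1) \<and> u' T1 > 0}"

definition C_lt ::
  "real \<Rightarrow> real \<Rightarrow> (real \<Rightarrow> real) \<Rightarrow> (real \<Rightarrow> real) \<Rightarrow> (real \<Rightarrow> real) \<Rightarrow> (real \<Rightarrow> real) \<Rightarrow>
    nat \<Rightarrow> (real \<times> real) set" where
  "C_lt T1 T2 p q m n k =
     {(a, b). \<exists>u u'. is_solution T1 T2 p q m n a b u u' \<and> has_zeros T1 T2 u (k - 1) \<and> u' T1 < 0}"

definition ecard :: "'a set \<Rightarrow> enat" where
  "ecard S = (if finite S then enat (card S) else \<infinity>)"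

(* Indices are counted, not sets: C_gt and C_lt contribute separately even where they coincide. *)

definition num_nonempty ::
  "real \<Rightarrow> real \<Rightarrow> (real \<Rightarrow> real) \<Rightarrow> (real \<Rightarrow> real) \<Rightarrow> (real \<Rightarrow> real) \<Rightarrow> (real \<Rightarrow> real) \<Rightarrow>
    (real \<times> real) set \<Rightarrow> enat" where
  "num_nonempty T1 T2 p q m n Q =
     ecard {k. k \<ge> 2 \<and> C_gt T1 T2 p q m n k \<inter> Q \<noteq> {}} +
     ecard {k. k \<ge> 2 \<and> C_lt T1 T2 p q m n k \<inter> Q \<noteq> {}}"

definition changes_sign :: "real \<Rightarrow> real \<Rightarrow> (real \<Rightarrow> real) \<Rightarrow> bool" where
  "changes_sign T1 T2 f \<longleftrightarrow>
     (\<exists>t\<in>{T1<..<T2}. max (f t) 0 \<noteq> 0) \<and> (\<exists>t\<in>{T1<..<T2}. max (- f t) 0 \<noteq> 0)"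

end

theory Submission
  imports Defs
begin

text \<open>
  For fixed signs of \<open>a\<close> and \<open>b\<close>, a set \<open>C\<^sub>k\<close> meets the corresponding open quadrant iff one can
  find \<open>k\<close> points \<open>t\<^sub>1 < \<dots> < t\<^sub>k\<close> in the open interval at which, alternately, the weight of the
  positive part and the weight of the negative part have the sign of their coefficient
  (\<open>C_gt_quadrant_iff\<close>, and \<open>C_lt_iff_C_gt\<close> for the other initial slope).  So the count of
  nonempty sets depends only on how the signs of \<open>m\<close> and \<open>n\<close> alternate.

  Such points are necessary: on a nodal interval where \<open>u > 0\<close> and \<open>a m \<le> 0\<close> the flux \<open>p u'\<close>
  would be nondecreasing, so \<open>u\<close> could not return to zero (\<open>positive_arch\<close>); zeros are simple
  because a common zero of \<open>u\<close> and \<open>u'\<close> forces \<open>u = 0\<close>, so consecutive nodal intervals have opposite signs.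

  They are sufficient: put \<open>a = \<plusminus>l\<close>, \<open>b = \<plusminus>l\<close> and follow the Pruefer angle of the solution
  starting with slope of the right sign.  It depends continuously on \<open>l\<close>, it can cross multiples of
  \<open>\<pi>\<close> only upwards, and for large \<open>l\<close> it gains \<open>\<pi>\<close> near each of the \<open>k\<close> points
  (\<open>pruefer_large\<close>).  For \<open>l = 0\<close> it stays below \<open>\<pi>\<close>, by the necessity part.  The intermediate value
  theorem gives \<open>l > 0\<close> for which the final angle is \<open>k \<pi>\<close>: a solution with \<open>k - 1\<close> interior zeros.

  What remains is combinatorial.  A weight pair is encoded as a word, whose letters
  give the signs of \<open>m\<close> and \<open>n\<close> on successive cells.  Consider the four pairs
  \<open>m > 0, n > 0\<close>; \<open>m < 0, n < 0\<close>; \<open>m > 0, n < 0\<close>; \<open>m < 0, n > 0\<close>.  If the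
  longest alternation for one of these pairs has length \<open>j + 2\<close>, then starting with the
  other class gives length \<open>j + 1\<close>, and counting indices \<open>k \<ge> 2\<close> yields \<open>(j + 1) + j = 2 j + 1\<close>
  nonempty sets; this is the source of the odd numbers.  It then suffices to find a word in which
  the four alternation lengths are \<open>K + 2\<close>, \<open>L + 2\<close>, \<open>M + 2\<close>, \<open>N + 2\<close> (\<open>word_exists\<close>).  Infinite
  lengths come from a letter at which \<open>m\<close> and \<open>n\<close> are nonzero simultaneously.
\<close>

section \<open>Alternating points\<close>

text \<open>
  The recursion removes the first point and swaps the predicates.  This matches the passage to the next
  nodal interval of a solution \<open>u\<close>, where \<open>u\<close> is replaced by \<open>-u\<close> and the two weights change places.
\<close>

fun alternates :: "(real \<Rightarrow> bool) \<Rightarrow> (real \<Rightarrow> bool) \<Rightarrow> real \<Rightarrow> real \<Rightarrow> nat \<Rightarrow> bool" where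
  "alternates P Q s T 0 \<longleftrightarrow> True"
| "alternates P Q s T (Suc k) \<longleftrightarrow> (\<exists>t. s < t \<and> t < T \<and> P t \<and> alternates Q P t T k)"

lemma alternates_mono: "alternates P Q s T k \<Longrightarrow> s' \<le> s \<Longrightarrow> alternates P Q s' T k"
  by (cases k) (auto intro: less_le_trans le_less_trans)

lemma alternates_affine:
  assumes "d > 0"
  shows "alternates P Q (c + d * s) (c + d * T) k \<longleftrightarrow>
         alternates (\<lambda>t. P (c + d * t)) (\<lambda>t. Q (c + d * t)) s T k"
proof (induction k arbitrary: P Q s)
  case (Suc k)
  have "(\<exists>t. c + d * s < t \<and> t < c + d * T \<and> P t \<and> alternates Q P t (c + d * T) k) \<longleftrightarrow>
        (\<exists>t. c + d * s < c + d * t \<and> c + d * t < c + d * T \<and> P (c + d * t) \<and>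
             alternates Q P (c + d * t) (c + d * T) k)"
  proof safe
    fix t assume *: "c + d * s < t" "t < c + d * T" "P t" "alternates Q P t (c + d * T) k"
    have "t = c + d * ((t - c) / d)" using assms by simp
    with * show "\<exists>t. c + d * s < c + d * t \<and> c + d * t < c + d * T \<and> P (c + d * t) \<and>
             alternates Q P (c + d * t) (c + d * T) k" by metis
  qed blast
  then show ?case using assms by (simp add: Suc)
qed simp

lemma alternates_cong:
  assumes "\<And>t. s < t \<Longrightarrow> t < T \<Longrightarrow> P t = P' t" "\<And>t. s < t \<Longrightarrow> t < T \<Longrightarrow> Q t = Q' t"
  shows "alternates P Q s T k = alternates P' Q' s T k"
  using assms
proof (induction k arbitrary: P Q P' Q' s)
  case (Suc k)
  have "alternates Q P t T k = alternates Q' P' t T k" if "s < t" for t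
    using that by (intro Suc.IH Suc.prems) auto
  with Suc.prems show ?case by auto
qed simp

lemma alternates_skip:
  assumes "\<And>t. s < t \<Longrightarrow> t \<le> s' \<Longrightarrow> \<not> P t" "s \<le> s'"
  shows "alternates P Q s T k = alternates P Q s' T k"
proof (cases k)
  case (Suc j)
  then show ?thesis using assms by (auto simp: not_le[symmetric] intro: order_trans)
qed simp

lemma alternates_both:
  assumes "s < c" "c \<le> T" "\<And>t. s < t \<Longrightarrow> t < c \<Longrightarrow> P t \<and> Q t"
  shows "alternates P Q s T k"
  using assms
proof (induction k arbitrary: P Q s)
  case (Suc k)
  have "alternates Q P ((s + c) / 2) T k" using Suc.prems by (intro Suc.IH) auto
  then show ?case using Suc.prems by (auto intro!: exI[of _ "(s + c) / 2"])
qed simp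

section \<open>Nodal intervals of a solution\<close>

lemma continuous_on_Icc_bounded:
  fixes f :: "real \<Rightarrow> real"
  assumes "continuous_on {a..b} f"
  obtains B where "B > 0" "\<And>t. t \<in> {a..b} \<Longrightarrow> \<bar>f t\<bar> \<le> B"
proof -
  have "bounded (f ` {a..b})"
    using assms by (intro compact_imp_bounded compact_continuous_image) auto
  then show ?thesis using that by (auto simp: bounded_pos)
qed

lemma is_solution_uminus:
  assumes "is_solution T1 T2 p q m n a b u u'"
  shows "is_solution T1 T2 p q n m b a (\<lambda>t. - u t) (\<lambda>t. - u' t)"
proof -
  from assms obtain w where
    "\<forall>t\<in>{T1..T2}. ((\<lambda>s. p s * u' s) has_real_derivative w t) (at t within {T1..T2})"
    "continuous_on {T1..T2} w"
    "\<forall>t\<in>{T1<..<T2}. - w t + q t * u t = a * m t * max (u t) 0 - b * n t * max (- u t) 0"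
    unfolding is_solution_def by blast
  then have "\<exists>w. (\<forall>t\<in>{T1..T2}. ((\<lambda>s. p s * (- u' s)) has_real_derivative w t) (at t within {T1..T2})) \<and>
          continuous_on {T1..T2} w \<and>
          (\<forall>t\<in>{T1<..<T2}.
             - w t + q t * (- u t) = b * n t * max (- u t) 0 - a * m t * max (- (- u t)) 0)"
    by (intro exI[of _ "\<lambda>t. - w t"] conjI)
       (force intro!: continuous_intros DERIV_minus)+
  with assms show ?thesis
    unfolding is_solution_def by (auto intro!: continuous_intros derivative_eq_intros)
qed

lemma abs_max_0_le: "\<bar>max x 0\<bar> \<le> \<bar>x::real\<bar>" "\<bar>max (- x) 0\<bar> \<le> \<bar>x\<bar>"
  by auto

text \<open>
  The nonlinearity is bounded by a multiple of \<open>\<bar>u\<bar>\<close>, so \<open>E = u\<^sup>2 + (p u')\<^sup>2\<close> satisfies \<open>\<bar>E'\<bar> \<le> C E\<close>.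
  Hence \<open>E exp (-C t)\<close> is nonincreasing and \<open>E exp (C t)\<close> nondecreasing, and a zero of \<open>E\<close> propagates
  in both directions.  This is what makes the zeros of a nontrivial solution simple.
\<close>

lemma solution_zero_if_zero_state:
  assumes sol: "is_solution T1 T2 p q m n a b u u'"
    and cont: "continuous_on {T1..T2} p" "continuous_on {T1..T2} q"
      "continuous_on {T1..T2} m" "continuous_on {T1..T2} n"
    and p: "\<forall>t\<in>{T1..T2}. p t > 0"
    and z: "z \<in> {T1..T2}" "u z = 0" "u' z = 0" and t: "t \<in> {T1..T2}"
  shows "u t = 0"
proof -
  obtain w where
    du: "\<forall>t\<in>{T1..T2}. (u has_real_derivative u' t) (at t within {T1..T2})" and
    dv: "\<forall>t\<in>{T1..T2}. ((\<lambda>s. p s * u' s) has_real_derivative w t) (at t within {T1..T2})" and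
    eq: "\<forall>t\<in>{T1<..<T2}. - w t + q t * u t = a * m t * max (u t) 0 - b * n t * max (- u t) 0"
    using sol unfolding is_solution_def by blast
  have "continuous_on {T1..T2} (\<lambda>t. 1 / p t)"
    using cont(1) p by (intro continuous_intros) force+
  then obtain C0 where C0: "C0 > 0" "\<And>t. t \<in> {T1..T2} \<Longrightarrow> \<bar>1 / p t\<bar> \<le> C0"
    using continuous_on_Icc_bounded by blast
  have "continuous_on {T1..T2} (\<lambda>t. \<bar>q t\<bar> + \<bar>a * m t\<bar> + \<bar>b * n t\<bar>)"
    using cont by (intro continuous_intros)
  then obtain C1 where C1: "C1 > 0"
    "\<And>t. t \<in> {T1..T2} \<Longrightarrow> \<bar>\<bar>q t\<bar> + \<bar>a * m t\<bar> + \<bar>b * n t\<bar>\<bar> \<le> C1"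
    using continuous_on_Icc_bounded by blast
  define v where "v = (\<lambda>s. p s * u' s)"
  define E where "E = (\<lambda>s. (u s)\<^sup>2 + (v s)\<^sup>2)"
  define C where "C = C0 + C1"
  define E' where "E' = (\<lambda>s. 2 * u s * u' s + 2 * v s * w s)"
  have dE: "(E has_real_derivative E' s) (at s within {T1..T2})" if "s \<in> {T1..T2}" for s
    unfolding E_def E'_def using du[rule_format, OF that] dv[rule_format, OF that, folded v_def]
    by (auto intro!: derivative_eq_intros)
  have bound: "\<bar>E' s\<bar> \<le> C * E s" if s: "T1 < s" "s < T2" for s
  proof -
    have "\<bar>u' s\<bar> = \<bar>1 / p s\<bar> * \<bar>v s\<bar>" using p[rule_format, of s] s by (simp add: v_def abs_mult)
    also have "\<dots> \<le> C0 * \<bar>v s\<bar>" using C0 s by (intro mult_right_mono) auto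
    finally have u': "\<bar>u' s\<bar> \<le> C0 * \<bar>v s\<bar>" .
    have "w s = q s * u s - a * m s * max (u s) 0 + b * n s * max (- u s) 0"
      using eq s by force
    then have "\<bar>w s\<bar> \<le> \<bar>q s * u s\<bar> + \<bar>a * m s * max (u s) 0\<bar> + \<bar>b * n s * max (- u s) 0\<bar>"
      by linarith
    also have "\<dots> \<le> \<bar>q s\<bar> * \<bar>u s\<bar> + \<bar>a * m s\<bar> * \<bar>u s\<bar> + \<bar>b * n s\<bar> * \<bar>u s\<bar>"
      unfolding abs_mult[of _ "max _ 0"] abs_mult[of "q s"]
      by (intro add_mono mult_left_mono abs_max_0_le) auto
    also have "\<dots> = (\<bar>q s\<bar> + \<bar>a * m s\<bar> + \<bar>b * n s\<bar>) * \<bar>u s\<bar>" by (simp add: algebra_simps)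
    also have "\<dots> \<le> C1 * \<bar>u s\<bar>" using C1(2)[of s] s by (intro mult_right_mono) auto
    finally have w: "\<bar>w s\<bar> \<le> C1 * \<bar>u s\<bar>" .
    have "\<bar>E' s\<bar> \<le> 2 * \<bar>u s\<bar> * \<bar>u' s\<bar> + 2 * \<bar>v s\<bar> * \<bar>w s\<bar>"
      unfolding E'_def by (rule order_trans[OF abs_triangle_ineq]) (simp add: abs_mult)
    also have "\<dots> \<le> 2 * \<bar>u s\<bar> * (C0 * \<bar>v s\<bar>) + 2 * \<bar>v s\<bar> * (C1 * \<bar>u s\<bar>)"
      using u' w by (intro add_mono mult_left_mono) auto
    also have "\<dots> = C * (2 * \<bar>u s\<bar> * \<bar>v s\<bar>)" by (simp add: C_def algebra_simps)
    also have "\<dots> \<le> C * E s"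
      using C0 C1 sum_squares_bound[of "\<bar>u s\<bar>" "\<bar>v s\<bar>"]
      by (intro mult_left_mono) (auto simp: C_def E_def)
    finally show ?thesis .
  qed
  have contE: "continuous_on {T1..T2} E"
    using dE by (meson DERIV_continuous continuous_on_eq_continuous_within)
  have Ez: "E z = 0" using z by (simp add: E_def v_def)
  have "E t \<le> 0"
  proof (cases "z \<le> t")
    case True
    have "- (E z * exp (- C * z)) \<le> - (E t * exp (- C * t))"
    proof (rule DERIV_nonneg_imp_increasing_open[OF True])
      fix s assume s: "z < s" "s < t"
      then have s': "T1 < s" "s < T2" using z t by auto
      have "(E has_real_derivative E' s) (at s)"
        using dE[of s] s' by (simp add: at_within_Icc_at)
      then have "((\<lambda>s. - (E s * exp (- C * s))) has_real_derivative (C * E s - E' s) * exp (- C * s)) (at s)"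
        by (auto intro!: derivative_eq_intros simp: algebra_simps)
      moreover have "C * E s - E' s \<ge> 0" using bound[OF s'] by linarith
      ultimately show "\<exists>y. ((\<lambda>s. - (E s * exp (- C * s))) has_real_derivative y) (at s) \<and> 0 \<le> y"
        by (auto intro!: exI)
    next
      show "continuous_on {z..t} (\<lambda>s. - (E s * exp (- C * s)))"
        using continuous_on_subset[OF contE, of "{z..t}"] z t by (auto intro!: continuous_intros)
    qed
    then show ?thesis using Ez by (simp add: mult_le_0_iff)
  next
    case False
    then have le: "t \<le> z" by simp
    have "E t * exp (C * t) \<le> E z * exp (C * z)"
    proof (rule DERIV_nonneg_imp_increasing_open[OF le])
      fix s assume s: "t < s" "s < z"
      then have s': "T1 < s" "s < T2" using z t by auto
      have "(E has_real_derivative E' s) (at s)"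
        using dE[of s] s' by (simp add: at_within_Icc_at)
      then have "((\<lambda>s. E s * exp (C * s)) has_real_derivative (C * E s + E' s) * exp (C * s)) (at s)"
        by (auto intro!: derivative_eq_intros simp: algebra_simps)
      moreover have "C * E s + E' s \<ge> 0" using bound[OF s'] by linarith
      ultimately show "\<exists>y. ((\<lambda>s. E s * exp (C * s)) has_real_derivative y) (at s) \<and> 0 \<le> y"
        by (auto intro!: exI)
    next
      show "continuous_on {t..z} (\<lambda>s. E s * exp (C * s))"
        using continuous_on_subset[OF contE, of "{t..z}"] z t by (auto intro!: continuous_intros)
    qed
    then show ?thesis using Ez by (simp add: mult_le_0_iff)
  qed
  then show ?thesis unfolding E_def by (smt (verit) zero_le_power2 power2_less_eq_zero_iff)
qed

text \<open>
  Otherwise \<open>(p u')' = (q - a m) u \<ge> 0\<close> along the arch.  By the mean value theorem \<open>p u'\<close> is positive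
  somewhere in its first half, hence from there on, so \<open>u\<close> keeps increasing and cannot vanish at \<open>z\<close>.
\<close>

lemma positive_arch:
  assumes sol: "is_solution T1 T2 p q m n a b u u'"
    and p: "\<forall>t\<in>{T1..T2}. p t > 0" and q: "\<forall>t\<in>{T1..T2}. q t \<ge> 0"
    and s: "T1 \<le> s" "s < z" "z \<le> T2" and u: "u s = 0" "u z = 0"
    and pos: "\<And>t. s < t \<Longrightarrow> t < z \<Longrightarrow> u t > 0"
  obtains t where "s < t" "t < z" "a * m t > 0"
proof (rule ccontr)
  assume no: "\<not> thesis"
  note obtained = that
  have am: "a * m t \<le> 0" if t: "s < t" "t < z" for t using no obtained[OF t] by force
  obtain w where
    du: "\<forall>t\<in>{T1..T2}. (u has_real_derivative u' t) (at t within {T1..T2})" and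
    dv: "\<forall>t\<in>{T1..T2}. ((\<lambda>s. p s * u' s) has_real_derivative w t) (at t within {T1..T2})" and
    eq: "\<forall>t\<in>{T1<..<T2}. - w t + q t * u t = a * m t * max (u t) 0 - b * n t * max (- u t) 0"
    using sol unfolding is_solution_def by blast
  have du': "(u has_real_derivative u' t) (at t)" if "s < t" "t < z" for t
    using du[rule_format, of t] that s by (simp add: at_within_Icc_at)
  have contu: "continuous_on {T1..T2} u"
    using du by (meson DERIV_continuous continuous_on_eq_continuous_within)
  have contv: "continuous_on {T1..T2} (\<lambda>s. p s * u' s)"
    using dv by (meson DERIV_continuous continuous_on_eq_continuous_within)
  define x where "x = (s + z) / 2"
  have x: "s < x" "x < z" using s by (auto simp: x_def)
  have "\<exists>l \<xi>. s < \<xi> \<and> \<xi> < x \<and> (u has_real_derivative l) (at \<xi>) \<and> u x - u s = (x - s) * l"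
    using x s by (intro MVT continuous_on_subset[OF contu])
      (auto simp: real_differentiable_def intro!: exI du')
  then obtain l \<xi> where \<xi>: "s < \<xi>" "\<xi> < x" "(u has_real_derivative l) (at \<xi>)" "u x = (x - s) * l"
    using u by auto
  then have "l > 0" using pos[OF x] x by (simp add: zero_less_mult_iff)
  moreover have "u' \<xi> = l" using du'[of \<xi>] \<xi> x by (auto intro: DERIV_unique)
  ultimately have v\<xi>: "p \<xi> * u' \<xi> > 0" using p \<xi> x s by auto
  have "p \<xi> * u' \<xi> \<le> p t * u' t" if t: "\<xi> < t" "t < z" for t
  proof (rule DERIV_nonneg_imp_increasing_open[OF less_imp_le[OF t(1)]])
    fix r assume r: "\<xi> < r" "r < t"
    then have r': "s < r" "r < z" using \<xi> t by auto
    then have "((\<lambda>s. p s * u' s) has_real_derivative w r) (at r)"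
      using dv[rule_format, of r] s by (simp add: at_within_Icc_at)
    moreover have "w r = q r * u r - a * m r * u r"
      using eq[rule_format, of r] r' s pos[of r] by (auto simp: max_def)
    moreover have "q r * u r \<ge> 0" "a * m r * u r \<le> 0"
      using q r' s pos[of r] am[of r] by (auto simp: mult_le_0_iff zero_le_mult_iff)
    ultimately show "\<exists>y. ((\<lambda>s. p s * u' s) has_real_derivative y) (at r) \<and> 0 \<le> y" by auto
  next
    show "continuous_on {\<xi>..t} (\<lambda>s. p s * u' s)"
      using continuous_on_subset[OF contv] \<xi> t s by auto
  qed
  then have "p t * u' t > 0" if "\<xi> < t" "t < z" for t using v\<xi> that by fastforce
  then have u'pos: "u' t > 0" if "\<xi> < t" "t < z" for t
    using p[rule_format, of t] that \<xi> x s by (smt (verit) atLeastAtMost_iff zero_less_mult_iff)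
  have "u x < u z"
  proof (rule DERIV_pos_imp_increasing_open[OF x(2)])
    show "\<exists>y. (u has_real_derivative y) (at r) \<and> 0 < y" if "x < r" "r < z" for r
      using du'[of r] u'pos[of r] that x \<xi> by auto
    show "continuous_on {x..z} u" using continuous_on_subset[OF contu] x s by auto
  qed
  with pos[OF x] u show False by simp
qed

text \<open>
  The first nodal interval contributes its point by \<open>positive_arch\<close>.  Unless its right end is \<open>T2\<close>, the slope
  there is strictly negative, because zeros are simple, so \<open>-u\<close> satisfies the same assumptions on the rest of
  the interval with the two weights interchanged and one zero fewer.
\<close>

lemma solution_alternates:
  assumes "is_solution T1 T2 p q m n a b u u'"
    and p: "continuous_on {T1..T2} p" "\<forall>t\<in>{T1..T2}. p t > 0"
    and q: "continuous_on {T1..T2} q" "\<forall>t\<in>{T1..T2}. q t \<ge> 0"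
    and "continuous_on {T1..T2} m" "continuous_on {T1..T2} n"
    and "T1 \<le> s" "s < T2" "u s = 0" "u' s > 0"
    and "finite {t \<in> {s<..<T2}. u t = 0}" "card {t \<in> {s<..<T2}. u t = 0} = j"
  shows "alternates (\<lambda>t. a * m t > 0) (\<lambda>t. b * n t > 0) s T2 (Suc j)"
  using assms(1,6-)
proof (induction j arbitrary: m n a b u u' s rule: less_induct)
  case (less j m n a b u u' s)
  note sol = less.prems(1) and fin = less.prems(8) and crd = less.prems(9)
  note s = less.prems(4,5)
  define Z where "Z = {t \<in> {s<..<T2}. u t = 0}"
  \<comment> \<open>The right end of the first nodal interval: the solution vanishes at \<open>T2\<close> too.\<close>
  define z where "z = (if Z = {} then T2 else Min Z)"
  have finZ: "finite Z" using fin by (simp add: Z_def)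
  have zZ: "z \<in> Z" if "Z \<noteq> {}" using Min_in[OF finZ that] that by (simp add: z_def)
  have z: "s < z" "z \<le> T2" "u z = 0"
  proof -
    have "u T2 = 0" using sol by (simp add: is_solution_def)
    then have "s < z \<and> z \<le> T2 \<and> u z = 0"
    proof (cases "Z = {}")
      case False
      then show ?thesis using zZ by (simp add: Z_def)
    qed (use s \<open>u T2 = 0\<close> in \<open>simp add: z_def\<close>)
    then show "s < z" "z \<le> T2" "u z = 0" by auto
  qed
  have nz: "u t \<noteq> 0" if "s < t" "t < z" for t
  proof
    assume "u t = 0"
    then have "t \<in> Z" using that z by (simp add: Z_def)
    then have "z \<le> t" using finZ by (auto simp: z_def)
    then show False using that by simp
  qed
  have du: "\<And>t. t \<in> {T1..T2} \<Longrightarrow> (u has_real_derivative u' t) (at t within {T1..T2})"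
    using sol unfolding is_solution_def by blast
  have contu: "continuous_on {T1..T2} u"
    using du by (meson DERIV_continuous continuous_on_eq_continuous_within)
  have "\<exists>d>0. \<forall>h>0. s + h \<in> {T1..T2} \<longrightarrow> h < d \<longrightarrow> u s < u (s + h)"
    using less.prems s by (intro has_real_derivative_pos_inc_right[OF du]) auto
  then obtain d where d: "d > 0" "\<And>h. 0 < h \<Longrightarrow> s + h \<in> {T1..T2} \<Longrightarrow> h < d \<Longrightarrow> u (s + h) > 0"
    using less.prems by auto
  have pos: "u t > 0" if t: "s < t" "t < z" for t
  proof (rule ccontr)
    assume "\<not> u t > 0"
    then have "u t \<le> 0" by simp
    define h where "h = min d (t - s) / 2"
    have h: "0 < h" "h < d" "s + h < t" using d t by (auto simp: h_def min_def field_simps)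
    then have "u (s + h) > 0" using d(2)[of h] t z s by auto
    have "continuous_on {s + h..t} u" using continuous_on_subset[OF contu] h t z s by auto
    then have "\<exists>x\<ge>s + h. x \<le> t \<and> u x = 0"
      using \<open>u t \<le> 0\<close> \<open>u (s + h) > 0\<close> h by (intro IVT2') auto
    then obtain x where "s + h \<le> x" "x \<le> t" "u x = 0" by blast
    then show False using nz[of x] h t by auto
  qed
  obtain t where t: "s < t" "t < z" "a * m t > 0"
    using positive_arch[OF sol p(2) q(2) s(1) z(1,2) less.prems(6) z(3) pos] by blast
  show ?case
  proof (cases "Z = {}")
    case True
    then have "j = 0" using crd unfolding Z_def[symmetric] by simp
    then show ?thesis using t z by auto
  next
    case False
    with zZ have zZ: "z \<in> Z" by simp
    then have zT: "z < T2" by (simp add: Z_def)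
    define Z' where "Z' = {t \<in> {z<..<T2}. - u t = 0}"
    have "Z' = Z - {z}"
    proof (intro equalityI subsetI)
      fix r assume "r \<in> Z - {z}"
      then show "r \<in> Z'" using nz[of r] by (force simp: Z_def Z'_def)
    qed (use z in \<open>auto simp: Z_def Z'_def\<close>)
    then have Z': "finite Z'" "Suc (card Z') = j"
      using finZ card.remove[OF finZ zZ] crd unfolding Z_def[symmetric] by (simp_all only: finite_Diff)
    have "u' z \<le> 0"
    proof (rule ccontr)
      assume "\<not> u' z \<le> 0"
      then have "\<exists>d>0. \<forall>h>0. z - h \<in> {T1..T2} \<longrightarrow> h < d \<longrightarrow> u (z - h) < u z"
        using z s by (intro has_real_derivative_pos_inc_left[OF du]) auto
      then obtain e where e: "e > 0" "\<And>h. 0 < h \<Longrightarrow> z - h \<in> {T1..T2} \<Longrightarrow> h < e \<Longrightarrow> u (z - h) < 0"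
        using z by auto
      define h where "h = min e (z - s) / 2"
      have h: "0 < h" "h < e" "s < z - h" using e z by (auto simp: h_def min_def field_simps)
      then show False using e(2)[of h] pos[of "z - h"] z s by auto
    qed
    moreover have "u' z \<noteq> 0"
    proof
      assume "u' z = 0"
      then have "u r = 0" if "r \<in> {T1..T2}" for r
        using solution_zero_if_zero_state[OF sol p(1) q(1) less.prems(2,3) p(2) _ z(3) _ that] z s
        by auto
      then have "u t = 0" using t z s by auto
      then show False using pos t by force
    qed
    ultimately have u'z: "- u' z > 0" by simp
    have "alternates (\<lambda>t. b * n t > 0) (\<lambda>t. a * m t > 0) z T2 (Suc (card Z'))"
    proof (rule less.IH[OF _ is_solution_uminus[OF sol] less.prems(3,2)])
      show "card Z' < j" using Z'(2) by simp
      show "finite {t \<in> {z<..<T2}. - u t = 0}" "card {t \<in> {z<..<T2}. - u t = 0} = card Z'"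
        using Z'(1) by (simp_all only: Z'_def)
    qed (use z zT s u'z in auto)
    then have "alternates (\<lambda>t. b * n t > 0) (\<lambda>t. a * m t > 0) t T2 j"
      unfolding Z' by (rule alternates_mono) (use t in simp)
    then show ?thesis using t z by auto
  qed
qed

section \<open>Initial value problems with a parameter\<close>

text \<open>
  After rescaling to the fixed interval \<open>[0, 1]\<close> the upper limit becomes an ordinary parameter of
  the integrand, and continuity of parameter integrals applies.
\<close>

lemma continuous_on_integral_upper_limit:
  fixes h :: "real \<Rightarrow> real \<Rightarrow> real" and c :: "'a::topological_space \<Rightarrow> real"
  assumes h: "continuous_on UNIV (\<lambda>(s, l). h s l)"
    and c: "continuous_on UNIV c" and e: "continuous_on UNIV e" and le: "\<And>x. T \<le> c x"
  shows "continuous_on UNIV (\<lambda>x. integral {T..c x} (\<lambda>s. h s (e x)))"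
proof -
  have hc: "continuous_on S (\<lambda>x. h (f x) (g x))" if "continuous_on S f" "continuous_on S g"
    for S and f g :: "'b::topological_space \<Rightarrow> real"
    using continuous_on_compose2[OF h continuous_on_Pair[OF that]] by auto
  have "integral {T..c x} (\<lambda>s. h s (e x)) =
        (c x - T) * integral (cbox 0 1) (\<lambda>r. h (T + (c x - T) * r) (e x))" for x
  proof -
    have "((\<lambda>r. (c x - T) *\<^sub>R h (T + (c x - T) * r) (e x)) has_integral
        integral {T + (c x - T) * 0..T + (c x - T) * 1} (\<lambda>s. h s (e x))) {0..1}"
    proof (rule has_integral_substitution[where c = T and d = "c x"])
      show "(\<lambda>r. T + (c x - T) * r) ` {0..1} \<subseteq> {T..c x}"
      proof safe
        fix r :: real assume "r \<in> {0..1}"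
        then have "0 \<le> (c x - T) * r" "(c x - T) * r \<le> c x - T"
          using le[of x] by (auto intro!: mult_nonneg_nonneg mult_left_le)
        then show "T + (c x - T) * r \<in> {T..c x}" by simp
      qed
    qed (use le[of x] in \<open>auto intro!: hc continuous_intros derivative_eq_intros\<close>)
    from integral_unique[OF this] show ?thesis by simp
  qed
  moreover have "continuous_on UNIV (\<lambda>x. integral (cbox 0 1) (\<lambda>r. h (T + (c x - T) * r) (e x)))"
  proof (rule integral_continuous_on_param)
    have "continuous_on (UNIV \<times> cbox (0::real) 1) (\<lambda>y. c (fst y))"
      "continuous_on (UNIV \<times> cbox (0::real) 1) (\<lambda>y. e (fst y))"
      by (rule continuous_on_compose2[OF c] continuous_on_compose2[OF e]; auto intro: continuous_intros)+
    then show "continuous_on (UNIV \<times> cbox 0 1) (\<lambda>(x, r). h (T + (c x - T) * r) (e x))"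
      unfolding split_def by (intro hc continuous_intros)
  qed
  ultimately show ?thesis using c by (auto intro!: continuous_intros)
qed

text \<open>
  Picard's theorem with the parameter \<open>l\<close> treated as a second variable of the unknown function, so that
  continuity in the parameter comes with existence: the fixed point is sought among the bounded
  continuous functions of \<open>(t, l)\<close>.  The weight \<open>exp (-2 L t)\<close> turns the integral operator into a
  contraction with factor \<open>1/2\<close> on the whole interval, however long.
\<close>

lemma picard_parameter:
  fixes g :: "real \<Rightarrow> real \<Rightarrow> real \<Rightarrow> real"
  assumes cont: "continuous_on UNIV (\<lambda>(t, x, l). g t x l)"
    and bdd: "\<And>t x l. \<bar>g t x l\<bar> \<le> B"
    and lip: "\<And>t x y l. \<bar>g t x l - g t y l\<bar> \<le> L * \<bar>x - y\<bar>" and L: "L > 0" and T: "T1 \<le> T2"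
  shows "\<exists>\<theta>. (\<forall>l. \<theta> T1 l = x0) \<and> continuous_on UNIV (\<theta> T2) \<and>
     (\<forall>t\<in>{T1..T2}. \<forall>l.
       ((\<lambda>t. \<theta> t l) has_real_derivative g t (\<theta> t l) l) (at t within {T1..T2}))"
proof -
  define c where "c t = max T1 (min T2 t)" for t
  have c: "T1 \<le> c t" "c t \<le> T2" for t using T by (auto simp: c_def)
  have c_id: "c t = t" if "t \<in> {T1..T2}" for t using that by (auto simp: c_def)
  have contc: "continuous_on UNIV c" unfolding c_def by (intro continuous_intros)
  have gc: "continuous_on S (\<lambda>x. g (e x) (f x) (k x))"
    if "continuous_on S e" "continuous_on S f" "continuous_on S k"
    for S and e f k :: "'b::topological_space \<Rightarrow> real"
    using continuous_on_compose2[OF cont continuous_on_Pair[OF that(1) continuous_on_Pair[OF that(2,3)]]]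
    by auto
  define G where "G f s l = g s (exp (2 * L * s) * apply_bcontfun f (s, l)) l"
    for f :: "(real \<times> real) \<Rightarrow>\<^sub>C real" and s l
  have contf: "continuous_on S (\<lambda>x. apply_bcontfun f (e x, k x))"
    if "continuous_on S e" "continuous_on S k"
    for S and e k :: "'b::topological_space \<Rightarrow> real" and f :: "(real \<times> real) \<Rightarrow>\<^sub>C real"
    using continuous_on_compose2[OF continuous_on_apply_bcontfun[of UNIV f] continuous_on_Pair[OF that]]
    by auto
  have contG: "continuous_on UNIV (\<lambda>(s, l). G f s l)" for f
    unfolding G_def split_def by (intro gc contf continuous_intros)
  have contG1: "continuous_on S (\<lambda>s. G f s l)" for f l S
    unfolding G_def by (intro gc contf continuous_intros)
  define \<Phi> where "\<Phi> f = (\<lambda>(t, l). exp (- (2 * L * c t)) * (x0 + integral {T1..c t} (\<lambda>s. G f s l)))" for f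
  have c2: "continuous_on UNIV (\<lambda>x::real\<times>real. c (fst x))"
    by (rule continuous_on_compose2[OF contc]) (auto intro: continuous_intros)
  have \<Phi>_bcont: "\<Phi> f \<in> bcontfun" for f
  proof (rule bcontfun_normI)
    show "continuous_on UNIV (\<Phi> f)"
      unfolding \<Phi>_def split_def
      by (intro continuous_intros continuous_on_integral_upper_limit contG c2 c)
    fix x :: "real \<times> real"
    have *: "\<bar>integral {T1..c (fst x)} (\<lambda>s. G f s (snd x))\<bar> \<le> B * (T2 - T1)"
    proof -
      have "norm (integral {T1..c (fst x)} (\<lambda>s. G f s (snd x))) \<le> B * (c (fst x) - T1)"
        by (rule integral_bound) (use c contG1 bdd in \<open>auto simp: G_def\<close>)
      also have "\<dots> \<le> B * (T2 - T1)"
        using c bdd[of 0 0 0] by (intro mult_left_mono) auto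
      finally show ?thesis by simp
    qed
    have "norm (\<Phi> f x) = exp (- (2 * L * c (fst x))) * \<bar>x0 + integral {T1..c (fst x)} (\<lambda>s. G f s (snd x))\<bar>"
      by (simp add: \<Phi>_def split_def abs_mult)
    also have "\<dots> \<le> exp (- (2 * L * T1)) * (\<bar>x0\<bar> + B * (T2 - T1))"
      using * c L by (intro mult_mono) (auto intro: order_trans[OF abs_triangle_ineq])
    finally show "norm (\<Phi> f x) \<le> exp (- (2 * L * T1)) * (\<bar>x0\<bar> + B * (T2 - T1))" .
  qed
  have app: "apply_bcontfun (Bcontfun (\<Phi> f)) = \<Phi> f" for f
    by (rule Bcontfun_inverse[OF \<Phi>_bcont])
  have "dist (Bcontfun (\<Phi> f)) (Bcontfun (\<Phi> h)) \<le> 1/2 * dist f h" for f h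
  proof (rule dist_bound)
    fix x :: "real \<times> real"
    obtain t l where x: "x = (t, l)" by fastforce
    define D where "D = dist f h"
    have expint: "((\<lambda>s. L * D * exp (2 * L * s)) has_integral
        (D / 2 * exp (2 * L * c t) - D / 2 * exp (2 * L * T1))) {T1..c t}"
      by (rule fundamental_theorem_of_calculus)
         (use c L in \<open>auto intro!: derivative_eq_intros simp: has_real_derivative_iff_has_vector_derivative[symmetric]\<close>)
    have "\<bar>integral {T1..c t} (\<lambda>s. G f s l) - integral {T1..c t} (\<lambda>s. G h s l)\<bar>
        = norm (integral {T1..c t} (\<lambda>s. G f s l - G h s l))"
      by (subst integral_diff) (auto intro!: integrable_continuous_real contG1)
    also have "\<dots> \<le> integral {T1..c t} (\<lambda>s. L * D * exp (2 * L * s))"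
    proof (rule integral_norm_bound_integral)
      show "(\<lambda>s. G f s l - G h s l) integrable_on {T1..c t}"
        by (intro integrable_continuous_real continuous_intros contG1)
      show "(\<lambda>s. L * D * exp (2 * L * s)) integrable_on {T1..c t}"
        using expint by (rule has_integral_integrable)
      fix s
      have "norm (G f s l - G h s l) \<le> L * \<bar>exp (2 * L * s) * apply_bcontfun f (s, l) - exp (2 * L * s) * apply_bcontfun h (s, l)\<bar>"
        unfolding G_def using lip by simp
      also have "\<dots> = L * exp (2 * L * s) * dist (apply_bcontfun f (s, l)) (apply_bcontfun h (s, l))"
        by (simp add: right_diff_distrib[symmetric] abs_mult dist_real_def)
      also have "\<dots> \<le> L * exp (2 * L * s) * D"
        unfolding D_def using L by (intro mult_left_mono dist_bounded) auto
      finally show "norm (G f s l - G h s l) \<le> L * D * exp (2 * L * s)" by (simp add: mult_ac)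
    qed
    also have "\<dots> \<le> D / 2 * exp (2 * L * c t)"
      using integral_unique[OF expint] by (simp add: D_def)
    finally have I: "\<bar>integral {T1..c t} (\<lambda>s. G f s l) - integral {T1..c t} (\<lambda>s. G h s l)\<bar>
        \<le> D / 2 * exp (2 * L * c t)" .
    have "dist (\<Phi> f x) (\<Phi> h x) = exp (- (2 * L * c t)) *
        \<bar>integral {T1..c t} (\<lambda>s. G f s l) - integral {T1..c t} (\<lambda>s. G h s l)\<bar>"
      by (simp add: x \<Phi>_def dist_real_def right_diff_distrib[symmetric] abs_mult)
    also have "\<dots> \<le> exp (- (2 * L * c t)) * (D / 2 * exp (2 * L * c t))"
      using I by (intro mult_left_mono) auto
    also have "\<dots> = 1/2 * D" by (simp add: exp_minus field_simps)
    finally show "dist (apply_bcontfun (Bcontfun (\<Phi> f)) x) (apply_bcontfun (Bcontfun (\<Phi> h)) x) \<le> 1/2 * dist f h"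
      by (simp add: app D_def)
  qed
  then obtain f where f: "Bcontfun (\<Phi> f) = f"
    using banach_fix_type[of "1/2" "\<lambda>f. Bcontfun (\<Phi> f)"] by auto
  have fp: "apply_bcontfun f (t, l) = exp (- (2 * L * c t)) * (x0 + integral {T1..c t} (\<lambda>s. G f s l))" for t l
    using app[of f] unfolding f by (simp add: \<Phi>_def)
  define \<theta> where "\<theta> t l = exp (2 * L * t) * apply_bcontfun f (t, l)" for t l
  have G\<theta>: "G f s l = g s (\<theta> s l) l" for s l by (simp add: G_def \<theta>_def)
  have \<theta>: "\<theta> t l = x0 + integral {T1..t} (\<lambda>s. G f s l)" if "t \<in> {T1..T2}" for t l
    using that by (simp add: \<theta>_def fp c_id mult.assoc[symmetric] exp_add[symmetric])
  show ?thesis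
  proof (intro exI[of _ \<theta>] conjI allI ballI)
    show "\<theta> T1 l = x0" for l using \<theta>[of T1 l] T by simp
    show "continuous_on UNIV (\<theta> T2)"
      unfolding \<theta>_def by (intro continuous_intros contf)
    fix t l assume t: "t \<in> {T1..T2}"
    have "((\<lambda>t. x0 + integral {T1..t} (\<lambda>s. G f s l)) has_real_derivative G f t l) (at t within {T1..T2})"
      using integral_has_real_derivative[OF contG1 t, of f l] by (auto intro!: derivative_eq_intros)
    then have "((\<lambda>t. \<theta> t l) has_real_derivative G f t l) (at t within {T1..T2})"
      by (rule has_field_derivative_transform_within[OF _ zero_less_one t]) (simp add: \<theta>)
    then show "((\<lambda>t. \<theta> t l) has_real_derivative g t (\<theta> t l) l) (at t within {T1..T2})"
      by (simp add: G\<theta>)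
  qed
qed

section \<open>The Pruefer angle\<close>

text \<open>
  For \<open>u = r sin \<theta>\<close> and \<open>p u' = r cos \<theta>\<close>, the equation
  \<open>-(p u')' + q u = A u\<^sup>+ - B u\<^sup>-\<close> with \<open>u\<^sup>\<plusminus> = max (\<plusminus>u) 0\<close> yields an equation for the angle that
  does not involve \<open>r\<close>, since the nonlinearity is positively homogeneous; this is its right-hand side.
\<close>

definition pruefer_field ::
  "(real \<Rightarrow> real) \<Rightarrow> (real \<Rightarrow> real) \<Rightarrow> (real \<Rightarrow> real) \<Rightarrow> (real \<Rightarrow> real) \<Rightarrow> real \<Rightarrow> real \<Rightarrow> real" where
  "pruefer_field p q A B t x = (cos x)\<^sup>2 / p t - q t * (sin x)\<^sup>2 +
     A t * (max (sin x) 0)\<^sup>2 + B t * (max (- sin x) 0)\<^sup>2"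

definition pruefer ::
  "real \<Rightarrow> real \<Rightarrow> (real \<Rightarrow> real) \<Rightarrow> (real \<Rightarrow> real) \<Rightarrow> (real \<Rightarrow> real) \<Rightarrow> (real \<Rightarrow> real) \<Rightarrow>
    (real \<Rightarrow> real) \<Rightarrow> bool" where
  "pruefer T1 T2 p q A B \<theta> \<longleftrightarrow>
     (\<forall>t\<in>{T1..T2}. (\<theta> has_real_derivative pruefer_field p q A B t (\<theta> t)) (at t within {T1..T2}))"

text \<open>
  If \<open>f t \<le> c\<close>, then \<open>f\<close> is below \<open>c\<close> at some \<open>y > s\<close>, just before \<open>t\<close> in the case of equality.  At the last point before \<open>y\<close>
  where \<open>f \<ge> c\<close>, the value is \<open>c\<close>, but there \<open>f\<close> is strictly increasing to the right.
\<close>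

lemma upcrossing_stays_above:
  fixes f :: "real \<Rightarrow> real"
  assumes df: "\<And>t. t \<in> {T1..T2} \<Longrightarrow> (f has_real_derivative f' t) (at t within {T1..T2})"
    and up: "\<And>t. t \<in> {T1..T2} \<Longrightarrow> f t = c \<Longrightarrow> f' t > 0"
    and st: "T1 \<le> s" "s < t" "t \<le> T2" and fs: "f s \<ge> c"
  shows "f t > c"
proof (rule ccontr)
  assume neg: "\<not> f t > c"
  have contf: "continuous_on {T1..T2} f"
    using df by (meson DERIV_continuous continuous_on_eq_continuous_within)
  obtain y where y: "s < y" "y \<le> t" "f y < c"
  proof (cases "f t = c")
    case True
    then have "\<exists>d>0. \<forall>h>0. t - h \<in> {T1..T2} \<longrightarrow> h < d \<longrightarrow> f (t - h) < f t"
      using st by (intro has_real_derivative_pos_inc_left[OF df] up) auto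
    then obtain d where d: "d > 0" "\<And>h. h > 0 \<Longrightarrow> t - h \<in> {T1..T2} \<Longrightarrow> h < d \<Longrightarrow> f (t - h) < f t"
      by auto
    define h where "h = min d (t - s) / 2"
    have h: "0 < h" "h < d" "s < t - h" using d st by (auto simp: h_def min_def field_simps)
    show ?thesis using that[of "t - h"] h d(2)[of h] True st by auto
  next
    case False
    then show ?thesis using that[of t] neg st by auto
  qed
  define X where "X = {x \<in> {s..y}. c \<le> f x}"
  have contsy: "continuous_on {s..y} f" using continuous_on_subset[OF contf] st y by auto
  have "closed ({s..y} \<inter> f -` {c..})"
    by (rule continuous_closed_preimage[OF contsy]) auto
  moreover have "X = {s..y} \<inter> f -` {c..}" by (auto simp: X_def)
  ultimately have "compact X"
    by (auto simp: compact_eq_bounded_closed intro: bounded_subset[OF bounded_closed_interval])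
  moreover have "s \<in> X" using fs y by (auto simp: X_def)
  ultimately obtain x where x: "x \<in> X" "\<And>r. r \<in> X \<Longrightarrow> r \<le> x"
    using compact_attains_sup[of X] by blast
  have xy: "s \<le> x" "x < y" "c \<le> f x" using x y by (auto simp: X_def order.order_iff_strict)
  have below: "f r < c" if "x < r" "r \<le> y" for r
    using x(2)[of r] that xy by (force simp: X_def)
  have "f x = c"
  proof (rule ccontr)
    assume "f x \<noteq> c"
    then have fx: "f x > c" using xy by simp
    have "\<exists>r\<ge>x. r \<le> y \<and> f r = c"
      using fx y xy continuous_on_subset[OF contsy] by (intro IVT2') auto
    then show False using below fx by (metis less_irrefl order.order_iff_strict)
  qed
  then have "\<exists>d>0. \<forall>h>0. x + h \<in> {T1..T2} \<longrightarrow> h < d \<longrightarrow> f x < f (x + h)"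
    using st xy y by (intro has_real_derivative_pos_inc_right[OF df] up) auto
  then obtain d where d: "d > 0" "\<And>h. h > 0 \<Longrightarrow> x + h \<in> {T1..T2} \<Longrightarrow> h < d \<Longrightarrow> f (x + h) > c"
    using \<open>f x = c\<close> by auto
  define h where "h = min d (y - x) / 2"
  have h: "0 < h" "h < d" "x + h < y" using d xy by (auto simp: h_def min_def field_simps)
  then show False using d(2)[of h] below[of "x + h"] st xy y by auto
qed

text \<open>
  At a multiple of \<open>\<pi>\<close> the sine vanishes and the field equals \<open>1 / p > 0\<close>, whatever the weights are.
\<close>

lemma pruefer_stays_above:
  fixes i :: int
  assumes \<theta>: "pruefer T1 T2 p q A B \<theta>" and p: "\<forall>t\<in>{T1..T2}. p t > 0"
    and st: "T1 \<le> s" "s < t" "t \<le> T2" and above: "\<theta> s \<ge> i * pi"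
  shows "\<theta> t > i * pi"
proof (rule upcrossing_stays_above[where f = \<theta> and f' = "\<lambda>t. pruefer_field p q A B t (\<theta> t)", OF _ _ st above])
  show "(\<theta> has_real_derivative pruefer_field p q A B t (\<theta> t)) (at t within {T1..T2})"
    if "t \<in> {T1..T2}" for t using \<theta> that by (auto simp: pruefer_def)
  show "pruefer_field p q A B t (\<theta> t) > 0" if t: "t \<in> {T1..T2}" and eq: "\<theta> t = i * pi" for t
  proof -
    have sin: "sin (\<theta> t) = 0" unfolding eq by (simp add: mult.commute)
    then have "(cos (\<theta> t))\<^sup>2 = 1" using sin_cos_squared_add[of "\<theta> t"] by simp
    then show ?thesis using sin p t by (simp add: pruefer_field_def)
  qed
qed

text \<open>
  Adding \<open>\<pi>\<close> to the angle replaces \<open>u\<close> by \<open>-u\<close>.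
\<close>

lemma pruefer_shift:
  assumes "pruefer T1 T2 p q A B \<theta>"
  shows "pruefer T1 T2 p q B A (\<lambda>t. \<theta> t - pi)"
  using assms unfolding pruefer_def
  by (auto intro!: derivative_eq_intros simp: pruefer_field_def)

lemma pruefer_continuous: "pruefer T1 T2 p q A B \<theta> \<Longrightarrow> continuous_on {T1..T2} \<theta>"
  unfolding pruefer_def by (meson DERIV_continuous continuous_on_eq_continuous_within)

text \<open>
  Where \<open>M \<ge> \<delta>\<close>, a large factor \<open>l\<close> drives the angle through a full half-turn.  As long as \<open>0 < \<theta> < \<pi>\<close> one
  has \<open>\<theta>' \<ge> cos\<^sup>2 \<theta> / P + (l \<delta> - Q) sin\<^sup>2 \<theta>\<close> with upper bounds \<open>P\<close>, \<open>Q\<close> of \<open>p\<close>, \<open>q\<close>.  For a small \<open>\<kappa>\<close> and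
  \<open>l \<delta> - Q \<ge> \<beta> = 1 / (P \<kappa>\<^sup>2)\<close> this is \<open>\<theta>' \<ge> \<beta> (sin\<^sup>2 \<theta> + \<kappa>\<^sup>2 cos\<^sup>2 \<theta>)\<close>, that is, the rescaled angle
  \<open>- arctan (\<kappa> cot \<theta>)\<close> has derivative at least \<open>\<kappa> \<beta> = 1 / (P \<kappa>)\<close>.  Since it takes values in an
  interval of length \<open>\<pi>\<close>, it cannot live long when \<open>\<kappa>\<close> is small.
\<close>

lemma pruefer_bump:
  assumes p: "continuous_on {T1..T2} p" "\<forall>t\<in>{T1..T2}. p t > 0" and q: "continuous_on {T1..T2} q"
    and cd: "T1 \<le> c" "c < d" "d \<le> T2" and \<delta>: "\<delta> > 0" "\<And>t. t \<in> {c..d} \<Longrightarrow> M t \<ge> \<delta>"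
  shows "\<exists>\<Lambda>\<ge>0. \<forall>l\<ge>\<Lambda>. \<forall>N \<theta>. pruefer T1 T2 p q (\<lambda>t. l * M t) N \<theta> \<longrightarrow> \<theta> c \<ge> 0 \<longrightarrow> \<theta> d \<ge> pi"
proof -
  obtain P where P: "P > 0" "\<And>t. t \<in> {T1..T2} \<Longrightarrow> \<bar>p t\<bar> \<le> P"
    using continuous_on_Icc_bounded[OF p(1)] by blast
  obtain Q where Q: "Q > 0" "\<And>t. t \<in> {T1..T2} \<Longrightarrow> \<bar>q t\<bar> \<le> Q"
    using continuous_on_Icc_bounded[OF q] by blast
  \<comment> \<open>Chosen so that \<open>\<kappa> \<beta> (d - c) / 2 = 2 \<pi>\<close>, which exceeds the room \<open>\<pi>\<close> of the arctangent.\<close>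
  define \<kappa> where "\<kappa> = (d - c) / (4 * pi * P)"
  have \<kappa>: "\<kappa> > 0" using cd P by (simp add: \<kappa>_def)
  define \<beta> where "\<beta> = 1 / (P * \<kappa>\<^sup>2)"
  have \<beta>: "\<beta> > 0" using P \<kappa> by (simp add: \<beta>_def)
  define \<Lambda> where "\<Lambda> = (Q + \<beta>) / \<delta>"
  have \<Lambda>: "\<Lambda> \<ge> 0" using Q \<beta> \<delta> by (simp add: \<Lambda>_def)
  show ?thesis
  proof (intro exI[of _ \<Lambda>] conjI allI impI \<Lambda>)
    fix l N \<theta>
    assume l: "l \<ge> \<Lambda>" and \<theta>: "pruefer T1 T2 p q (\<lambda>t. l * M t) N \<theta>" and start: "\<theta> c \<ge> 0"
    show "\<theta> d \<ge> pi"
    proof (rule ccontr)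
      assume neg: "\<not> \<theta> d \<ge> pi"
      have pos: "\<theta> t > 0" if "c < t" "t \<le> d" for t
        using pruefer_stays_above[OF \<theta> p(2), of c t 0] that cd start by auto
      have ltpi: "\<theta> t < pi" if "c < t" "t < d" for t
      proof (rule ccontr)
        assume "\<not> \<theta> t < pi"
        then show False using pruefer_stays_above[OF \<theta> p(2), of t d 1] that cd neg by auto
      qed
      define f where "f t = - arctan (\<kappa> * cot (\<theta> t))" for t
      define f' where "f' t = \<kappa> * pruefer_field p q (\<lambda>t. l * M t) N t (\<theta> t) / ((sin (\<theta> t))\<^sup>2 + \<kappa>\<^sup>2 * (cos (\<theta> t))\<^sup>2)" for t
      have df: "(f has_real_derivative f' t) (at t)" and f'ge: "f' t \<ge> \<kappa> * \<beta>" if t: "c < t" "t < d" for t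
      proof -
        have s: "sin (\<theta> t) > 0" using pos[of t] ltpi[of t] t by (intro sin_gt_zero) auto
        have d\<theta>: "(\<theta> has_real_derivative pruefer_field p q (\<lambda>t. l * M t) N t (\<theta> t)) (at t)"
          using \<theta>[unfolded pruefer_def, rule_format, of t] t cd by (simp add: at_within_Icc_at)
        have "(f has_real_derivative - (inverse (1 + (\<kappa> * cot (\<theta> t))\<^sup>2) *
            (\<kappa> * (- inverse ((sin (\<theta> t))\<^sup>2) * pruefer_field p q (\<lambda>t. l * M t) N t (\<theta> t))))) (at t)"
          unfolding f_def using s
          by (auto intro!: derivative_eq_intros DERIV_chain2[OF DERIV_cot d\<theta>])
        moreover have "- (inverse (1 + (\<kappa> * cot (\<theta> t))\<^sup>2) *
            (\<kappa> * (- inverse ((sin (\<theta> t))\<^sup>2) * F))) = \<kappa> * F / ((sin (\<theta> t))\<^sup>2 + \<kappa>\<^sup>2 * (cos (\<theta> t))\<^sup>2)" for F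
        proof -
          have "1 + (\<kappa> * cot (\<theta> t))\<^sup>2 = ((sin (\<theta> t))\<^sup>2 + \<kappa>\<^sup>2 * (cos (\<theta> t))\<^sup>2) / (sin (\<theta> t))\<^sup>2"
            using s by (simp add: cot_def power_mult_distrib power_divide field_simps)
          then show ?thesis using s by (simp add: field_simps)
        qed
        ultimately show "(f has_real_derivative f' t) (at t)" by (simp add: f'_def)
        have tT: "t \<in> {T1..T2}" using t cd by auto
        have "\<beta> * (\<kappa>\<^sup>2 * (cos (\<theta> t))\<^sup>2) = (cos (\<theta> t))\<^sup>2 / P"
          using P \<kappa> by (simp add: \<beta>_def field_simps)
        also have "\<dots> \<le> (cos (\<theta> t))\<^sup>2 / p t"
          using P(2)[OF tT] P(1) p(2) tT by (intro divide_left_mono) auto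
        finally have 1: "\<beta> * (\<kappa>\<^sup>2 * (cos (\<theta> t))\<^sup>2) \<le> (cos (\<theta> t))\<^sup>2 / p t" .
        have "Q + \<beta> \<le> l * \<delta>" using l \<delta> by (simp add: \<Lambda>_def field_simps)
        also have "\<dots> \<le> l * M t"
          using \<delta>(2)[of t] t l \<Lambda> by (intro mult_left_mono) auto
        finally have "\<beta> \<le> l * M t - q t" using Q(2)[OF tT] by linarith
        then have 2: "\<beta> * (sin (\<theta> t))\<^sup>2 \<le> (l * M t - q t) * (sin (\<theta> t))\<^sup>2"
          by (intro mult_right_mono) auto
        have "\<beta> * ((sin (\<theta> t))\<^sup>2 + \<kappa>\<^sup>2 * (cos (\<theta> t))\<^sup>2) \<le> pruefer_field p q (\<lambda>t. l * M t) N t (\<theta> t)"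
          using 1 2 s by (simp add: pruefer_field_def algebra_simps)
        moreover have "(sin (\<theta> t))\<^sup>2 + \<kappa>\<^sup>2 * (cos (\<theta> t))\<^sup>2 > 0" using s by (intro add_pos_nonneg) auto
        ultimately have "\<beta> \<le> pruefer_field p q (\<lambda>t. l * M t) N t (\<theta> t) / ((sin (\<theta> t))\<^sup>2 + \<kappa>\<^sup>2 * (cos (\<theta> t))\<^sup>2)"
          by (simp add: pos_le_divide_eq)
        then have "\<kappa> * \<beta> \<le> \<kappa> * (pruefer_field p q (\<lambda>t. l * M t) N t (\<theta> t) / ((sin (\<theta> t))\<^sup>2 + \<kappa>\<^sup>2 * (cos (\<theta> t))\<^sup>2))"
          using \<kappa> by (intro mult_left_mono) auto
        then show "f' t \<ge> \<kappa> * \<beta>" by (simp add: f'_def)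
      qed
      \<comment> \<open>The angle is known to lie strictly between \<open>0\<close> and \<open>\<pi>\<close> only inside, so the ends are cut off.\<close>
      define x y where "x = c + (d - c) / 4" and "y = c + 3 * (d - c) / 4"
      have xy: "c < x" "x < y" "y < d" "y - x = (d - c) / 2"
        using cd by (auto simp: x_def y_def field_simps)
      have "\<exists>z. x < z \<and> z < y \<and> f y - f x = (y - x) * f' z"
        using xy df by (intro MVT2) auto
      then obtain z where z: "x < z" "z < y" "f y - f x = (y - x) * f' z" by blast
      have "(y - x) * (\<kappa> * \<beta>) \<le> (y - x) * f' z"
        using f'ge[of z] z xy by (intro mult_left_mono) auto
      moreover have "(y - x) * (\<kappa> * \<beta>) = 2 * pi"
      proof -
        have "d - c = 4 * pi * P * \<kappa>" using P by (simp add: \<kappa>_def)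
        then show ?thesis using \<kappa> P by (simp add: xy(4) \<beta>_def power2_eq_square)
      qed
      moreover have "f y - f x < pi"
        using arctan_bounded[of "\<kappa> * cot (\<theta> x)"] arctan_bounded[of "\<kappa> * cot (\<theta> y)"]
        unfolding f_def by linarith
      ultimately show False using z pi_gt_zero by linarith
    qed
  qed
qed

text \<open>
  Each point of the alternation lies in a short interval on which the relevant weight is bounded below,
  so \<open>pruefer_bump\<close> gains \<open>\<pi>\<close> there; between these intervals nothing is lost by \<open>pruefer_stays_above\<close>.  After
  the first gain, \<open>\<theta> - \<pi>\<close> solves the equation with the weights interchanged.
\<close>

lemma pruefer_large:
  assumes p: "continuous_on {T1..T2} p" "\<forall>t\<in>{T1..T2}. p t > 0" and q: "continuous_on {T1..T2} q"
    and "continuous_on {T1..T2} M" "continuous_on {T1..T2} N"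
    and "T1 \<le> s" "s \<le> T2" "alternates (\<lambda>t. M t > 0) (\<lambda>t. N t > 0) s T2 k"
  shows "\<exists>\<Lambda>. \<forall>l\<ge>\<Lambda>. \<forall>\<theta>. pruefer T1 T2 p q (\<lambda>t. l * M t) (\<lambda>t. l * N t) \<theta> \<longrightarrow> \<theta> s \<ge> 0 \<longrightarrow> \<theta> T2 \<ge> k * pi"
  using assms(4-)
proof (induction k arbitrary: M N s)
  case 0
  have "\<theta> T2 \<ge> 0" if \<theta>: "pruefer T1 T2 p q A B \<theta>" and "\<theta> s \<ge> 0" for A B \<theta>
    using pruefer_stays_above[OF \<theta> p(2), of s T2 0] 0 that by (cases "s = T2") auto
  then show ?case by auto
next
  case (Suc k)
  note M = Suc.prems(1) and s = Suc.prems(3,4)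
  obtain t where t: "s < t" "t < T2" "M t > 0" "alternates (\<lambda>t. N t > 0) (\<lambda>t. M t > 0) t T2 k"
    using Suc.prems by auto
  obtain \<Lambda>1 where \<Lambda>1: "\<And>l \<theta>. l \<ge> \<Lambda>1 \<Longrightarrow> pruefer T1 T2 p q (\<lambda>t. l * N t) (\<lambda>t. l * M t) \<theta> \<Longrightarrow>
      \<theta> t \<ge> 0 \<Longrightarrow> \<theta> T2 \<ge> k * pi"
    using Suc.IH[OF Suc.prems(2,1) _ _ t(4)] t s by auto
  have "\<exists>e>0. \<forall>r\<in>{T1..T2}. dist r t < e \<longrightarrow> dist (M r) (M t) < M t / 2"
    using M[unfolded continuous_on_iff, rule_format, of t "M t / 2"] t s by auto
  then obtain e where e: "e > 0" "\<And>r. r \<in> {T1..T2} \<Longrightarrow> dist r t < e \<Longrightarrow> dist (M r) (M t) < M t / 2"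
    by blast
  define c where "c = t - min e (t - s) / 2"
  have c: "s < c" "c < t" "t - c < e" using e t by (auto simp: c_def min_def field_simps)
  have M_ge: "M r \<ge> M t / 2" if "r \<in> {c..t}" for r
  proof -
    have "dist (M r) (M t) < M t / 2" using that c t s by (intro e(2)) (auto simp: dist_real_def)
    then show ?thesis unfolding dist_real_def by linarith
  qed
  have c': "T1 \<le> c" "t \<le> T2" "M t / 2 > 0" using c t s by auto
  obtain \<Lambda>2 where \<Lambda>2: "\<And>l N \<theta>. l \<ge> \<Lambda>2 \<Longrightarrow> pruefer T1 T2 p q (\<lambda>t. l * M t) N \<theta> \<Longrightarrow> \<theta> c \<ge> 0 \<Longrightarrow> \<theta> t \<ge> pi"
    using pruefer_bump[where M = M, OF p q c'(1) c(2) c'(2,3) M_ge] by metis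
  show ?case
  proof (intro exI allI impI)
    fix l \<theta> assume l: "max \<Lambda>1 \<Lambda>2 \<le> l" and \<theta>: "pruefer T1 T2 p q (\<lambda>t. l * M t) (\<lambda>t. l * N t) \<theta>"
      and start: "\<theta> s \<ge> 0"
    have "\<theta> c \<ge> 0" using pruefer_stays_above[OF \<theta> p(2), of s c 0] c t s start by auto
    then have "\<theta> t - pi \<ge> 0" using \<Lambda>2[OF _ \<theta>] l by auto
    then have "\<theta> T2 - pi \<ge> k * pi" using \<Lambda>1[OF _ pruefer_shift[OF \<theta>]] l by auto
    then show "\<theta> T2 \<ge> Suc k * pi" by (simp add: algebra_simps)
  qed
qed

text \<open>
  The radius \<open>r\<close> is recovered by one integration, as its logarithmic derivative is determined by the
  angle.  The zeros of \<open>u = r sin \<theta>\<close> are the points where \<open>\<theta>\<close> is a multiple of \<open>\<pi>\<close>, and each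
  multiple strictly between \<open>0\<close> and \<open>k \<pi>\<close> is attained exactly once.
\<close>

lemma pruefer_solution:
  assumes p: "continuous_on {T1..T2} p" "\<forall>t\<in>{T1..T2}. p t > 0" and q: "continuous_on {T1..T2} q"
    and A: "continuous_on {T1..T2} A" and B: "continuous_on {T1..T2} B" and T: "T1 < T2"
    and \<theta>: "pruefer T1 T2 p q A B \<theta>" and \<theta>1: "\<theta> T1 = 0" and \<theta>2: "\<theta> T2 = k * pi"
  obtains u u' where "is_solution T1 T2 p q A B 1 1 u u'" "has_zeros T1 T2 u (k - 1)" "u' T1 > 0"
proof -
  \<comment> \<open>With this \<open>W\<close> the nonlinear term of the equation is \<open>r W\<close>.\<close>
  define W where "W t = A t * max (sin (\<theta> t)) 0 - B t * max (- sin (\<theta> t)) 0" for t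
  define \<rho> where "\<rho> t = (1 / p t + q t) * sin (\<theta> t) * cos (\<theta> t) - W t * cos (\<theta> t)" for t
  define r where "r t = exp (integral {T1..t} \<rho>)" for t
  define u where "u t = r t * sin (\<theta> t)" for t
  define u' where "u' t = r t * cos (\<theta> t) / p t" for t
  define w where "w t = q t * u t - r t * W t" for t
  note cont\<theta> = pruefer_continuous[OF \<theta>]
  have pnz: "p t \<noteq> 0" if "t \<in> {T1..T2}" for t using p(2) that by force
  have contW: "continuous_on {T1..T2} W" unfolding W_def by (intro continuous_intros A B cont\<theta>)
  have cont\<rho>: "continuous_on {T1..T2} \<rho>"
    unfolding \<rho>_def using pnz by (intro continuous_intros cont\<theta> p q contW) auto
  have d\<theta>: "(\<theta> has_real_derivative pruefer_field p q A B t (\<theta> t)) (at t within {T1..T2})"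
    if "t \<in> {T1..T2}" for t using \<theta> that by (auto simp: pruefer_def)
  have rpos: "r t > 0" for t by (simp add: r_def)
  have dr: "(r has_real_derivative r t * \<rho> t) (at t within {T1..T2})" if "t \<in> {T1..T2}" for t
    unfolding r_def using integral_has_real_derivative[OF cont\<rho> that]
    by (auto intro!: derivative_eq_intros)
  have contr: "continuous_on {T1..T2} r"
    using dr by (meson DERIV_continuous continuous_on_eq_continuous_within)
  have sW: "sin x * (a * max (sin x) 0 - b * max (- sin x) 0) = a * (max (sin x) 0)\<^sup>2 + b * (max (- sin x) 0)\<^sup>2"
    for a b x :: real by (auto simp: max_def power2_eq_square)
  have field: "pruefer_field p q A B t (\<theta> t) = (cos (\<theta> t))\<^sup>2 / p t - q t * (sin (\<theta> t))\<^sup>2 + sin (\<theta> t) * W t" for t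
    unfolding pruefer_field_def W_def sW by simp
  have c2: "(cos x)\<^sup>2 = 1 - (sin x)\<^sup>2" for x :: real by (simp add: cos_squared_eq)
  have alg_u: "R * ((1 / P + Q) * S * C - V * C) * S + R * (C * (C\<^sup>2 / P - Q * S\<^sup>2 + S * V)) =
      R * C / P * (S\<^sup>2 + C\<^sup>2)" for R P Q S C V :: real
    by (simp add: algebra_simps power2_eq_square add_divide_distrib)
  have alg_v: "R * ((1 / P + Q) * S * C - V * C) * C - R * (S * (C\<^sup>2 / P - Q * S\<^sup>2 + S * V)) =
      (Q * (R * S) - R * V) * (S\<^sup>2 + C\<^sup>2)" for R P Q S C V :: real
    by (simp add: algebra_simps power2_eq_square add_divide_distrib)
  have du: "(u has_real_derivative u' t) (at t within {T1..T2})" if t: "t \<in> {T1..T2}" for t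
  proof -
    have "(u has_real_derivative r t * \<rho> t * sin (\<theta> t) + r t * (cos (\<theta> t) * pruefer_field p q A B t (\<theta> t)))
        (at t within {T1..T2})"
      unfolding u_def using dr[OF t] d\<theta>[OF t] by (auto intro!: derivative_eq_intros)
    also have "r t * \<rho> t * sin (\<theta> t) + r t * (cos (\<theta> t) * pruefer_field p q A B t (\<theta> t)) =
        r t * cos (\<theta> t) / p t * ((sin (\<theta> t))\<^sup>2 + (cos (\<theta> t))\<^sup>2)"
      unfolding field \<rho>_def by (rule alg_u)
    finally show ?thesis by (simp add: u'_def)
  qed
  have dv: "((\<lambda>s. p s * u' s) has_real_derivative w t) (at t within {T1..T2})" if t: "t \<in> {T1..T2}" for t
  proof -
    have "((\<lambda>s. r s * cos (\<theta> s)) has_real_derivative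
        r t * \<rho> t * cos (\<theta> t) - r t * (sin (\<theta> t) * pruefer_field p q A B t (\<theta> t)))
        (at t within {T1..T2})"
      using dr[OF t] d\<theta>[OF t] by (auto intro!: derivative_eq_intros)
    also have "r t * \<rho> t * cos (\<theta> t) - r t * (sin (\<theta> t) * pruefer_field p q A B t (\<theta> t)) =
        (q t * (r t * sin (\<theta> t)) - r t * W t) * ((sin (\<theta> t))\<^sup>2 + (cos (\<theta> t))\<^sup>2)"
      unfolding field \<rho>_def by (rule alg_v)
    finally have "((\<lambda>s. r s * cos (\<theta> s)) has_real_derivative w t) (at t within {T1..T2})"
      by (simp add: w_def u_def)
    then show ?thesis
      by (rule has_field_derivative_transform_within[OF _ zero_less_one t]) (use pnz in \<open>simp add: u'_def\<close>)
  qed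
  have contu: "continuous_on {T1..T2} u" unfolding u_def by (intro continuous_intros contr cont\<theta>)
  have scale: "r t * max x 0 = max (r t * x) 0" for t x
    using rpos[of t] by (auto simp: max_def mult_le_0_iff zero_le_mult_iff)
  have sol: "is_solution T1 T2 p q A B 1 1 u u'"
    unfolding is_solution_def
  proof (intro conjI exI[of _ w] ballI)
    show "continuous_on {T1..T2} u'" unfolding u'_def
      using pnz by (intro continuous_intros contr cont\<theta> p) auto
    show "continuous_on {T1..T2} w" unfolding w_def
      by (intro continuous_intros contr contW contu q)
    have "sin (real k * pi) = 0" by simp
    then show "u T1 = 0" "u T2 = 0" by (simp_all add: u_def \<theta>1 \<theta>2)
    fix t
    have "r t * W t = A t * (r t * max (sin (\<theta> t)) 0) - B t * (r t * max (- sin (\<theta> t)) 0)"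
      by (simp add: W_def algebra_simps)
    also have "\<dots> = A t * max (u t) 0 - B t * max (- u t) 0"
      unfolding scale by (simp add: u_def)
    finally show "- w t + q t * u t = 1 * A t * max (u t) 0 - 1 * B t * max (- u t) 0"
      by (simp add: w_def)
  qed (use du dv in auto)
  define Z where "Z = {t \<in> {T1<..<T2}. u t = 0}"
  have range: "0 < \<theta> t" "\<theta> t < k * pi" if t: "T1 < t" "t < T2" for t
  proof -
    show "0 < \<theta> t" using pruefer_stays_above[OF \<theta> p(2), of T1 t 0] t \<theta>1 by auto
    show "\<theta> t < k * pi"
    proof (rule ccontr)
      assume "\<not> \<theta> t < k * pi"
      then show False using pruefer_stays_above[OF \<theta> p(2), of t T2 "int k"] t \<theta>2 by auto
    qed
  qed
  have "bij_betw (\<lambda>t. \<theta> t / pi) Z (real ` {1..<k})"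
    unfolding bij_betw_def
  proof (intro conjI inj_onI equalityI subsetI)
    have int: "\<exists>i. t \<in> {T1<..<T2} \<and> \<theta> t = of_int i * pi" if "t \<in> Z" for t
      using that rpos[of t] by (auto simp: Z_def u_def sin_zero_iff_int2)
    {
      fix s t assume st: "s \<in> Z" "t \<in> Z" "\<theta> s / pi = \<theta> t / pi"
      obtain i where i: "s \<in> {T1<..<T2}" "\<theta> s = of_int i * pi" using int[OF st(1)] by blast
      have "t \<in> {T1<..<T2}" "\<theta> t = of_int i * pi" using st i by (auto simp: Z_def)
      with i show "s = t"
        using pruefer_stays_above[OF \<theta> p(2), of s t i] pruefer_stays_above[OF \<theta> p(2), of t s i]
        by (cases s t rule: linorder_cases) auto
    next
      fix x assume "x \<in> (\<lambda>t. \<theta> t / pi) ` Z"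
      then obtain t where t: "t \<in> Z" "x = \<theta> t / pi" by blast
      then obtain i where i: "t \<in> {T1<..<T2}" "\<theta> t = of_int i * pi" using int by blast
      with range[of t] have "0 < real_of_int i" "real_of_int i < k" by (auto simp: zero_less_mult_iff)
      then have "nat i \<in> {1..<k}" "x = real (nat i)" using t i by auto
      then show "x \<in> real ` {1..<k}" by blast
    next
      fix x assume "x \<in> real ` {1..<k}"
      then obtain i where i: "x = real i" "1 \<le> i" "i < k" by auto
      have "\<exists>t\<ge>T1. t \<le> T2 \<and> \<theta> t = i * pi"
        using i T \<theta>1 \<theta>2 cont\<theta> by (intro IVT') auto
      then obtain t where t: "T1 \<le> t" "t \<le> T2" "\<theta> t = i * pi" by blast
      have "t \<noteq> T1" "t \<noteq> T2" using t i \<theta>1 \<theta>2 by auto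
      moreover have "u t = 0" by (simp add: u_def t)
      ultimately have "t \<in> Z" using t by (simp add: Z_def)
      then show "x \<in> (\<lambda>t. \<theta> t / pi) ` Z" using t i by (intro image_eqI[of _ _ t]) auto
    }
  qed
  moreover have "finite (real ` {1..<k})" "card (real ` {1..<k}) = k - 1"
    by (auto simp: card_image)
  ultimately have "finite Z" "card Z = k - 1"
    using bij_betw_finite bij_betw_same_card by (metis, metis)
  then have "has_zeros T1 T2 u (k - 1)" by (simp add: has_zeros_def Z_def)
  moreover have "u' T1 > 0" using rpos p(2) T by (simp add: u'_def \<theta>1)
  ultimately show thesis using sol that by blast
qed

lemma abs_cos_diff_le: "\<bar>cos x - cos y\<bar> \<le> \<bar>x - y\<bar>" for x y :: real
proof -
  have "\<bar>cos x - cos y\<bar> = 2 * (\<bar>sin ((x + y) / 2)\<bar> * \<bar>sin ((y - x) / 2)\<bar>)"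
    unfolding cos_diff_cos by (simp add: abs_mult)
  also have "\<dots> \<le> 2 * (1 * \<bar>(y - x) / 2\<bar>)"
    by (intro mult_left_mono mult_mono abs_sin_le_one abs_sin_x_le_abs_x) auto
  finally show ?thesis by simp
qed

lemma abs_sin_diff_le: "\<bar>sin x - sin y\<bar> \<le> \<bar>x - y\<bar>" for x y :: real
  using abs_cos_diff_le[of "pi/2 - x" "pi/2 - y"] unfolding cos_diff by simp

lemma abs_square_diff_le:
  fixes a b d :: real
  assumes "\<bar>a\<bar> \<le> 1" "\<bar>b\<bar> \<le> 1" "\<bar>a - b\<bar> \<le> d"
  shows "\<bar>a\<^sup>2 - b\<^sup>2\<bar> \<le> 2 * d"
proof -
  have "\<bar>a\<^sup>2 - b\<^sup>2\<bar> = \<bar>a + b\<bar> * \<bar>a - b\<bar>"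
    by (simp add: power2_eq_square square_diff_square_factored abs_mult)
  also have "\<dots> \<le> 2 * d" using assms by (intro mult_mono) auto
  finally show ?thesis .
qed

text \<open>
  The angle enters only through squares of functions bounded by \<open>1\<close> with Lipschitz constant \<open>1\<close>, so
  the field is globally bounded and globally Lipschitz; this is what lets the angle equation be
  solved on the whole interval.
\<close>

lemma pruefer_field_bounded_Lipschitz:
  assumes "\<bar>1 / p t\<bar> \<le> C" "\<bar>q t\<bar> \<le> C" "\<bar>A t\<bar> \<le> C" "\<bar>B t\<bar> \<le> C"
  shows "\<bar>pruefer_field p q A B t x\<bar> \<le> 4 * C"
    and "\<bar>pruefer_field p q A B t x - pruefer_field p q A B t y\<bar> \<le> 8 * C * \<bar>x - y\<bar>"
proof -
  have mono: "\<bar>c * s\<bar> \<le> C * r" if "\<bar>c\<bar> \<le> C" "\<bar>s\<bar> \<le> r" for c s r :: real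
    unfolding abs_mult using that by (intro mult_mono) auto
  have le: "\<bar>cos x\<bar> \<le> 1" "\<bar>sin x\<bar> \<le> 1" "\<bar>max (sin x) 0\<bar> \<le> 1" "\<bar>max (- sin x) 0\<bar> \<le> 1" for x :: real
    using abs_sin_le_one[of x] by (auto simp: abs_le_iff)
  have sq: "\<bar>a\<^sup>2\<bar> \<le> 1" if "\<bar>a\<bar> \<le> 1" for a :: real using that by (simp add: abs_square_le_1)
  have eq: "pruefer_field p q A B t x = 1 / p t * (cos x)\<^sup>2 - q t * (sin x)\<^sup>2 +
     A t * (max (sin x) 0)\<^sup>2 + B t * (max (- sin x) 0)\<^sup>2" for x by (simp add: pruefer_field_def)
  have sum4: "\<bar>a - b + c + d\<bar> \<le> \<bar>a\<bar> + \<bar>b\<bar> + \<bar>c\<bar> + \<bar>d\<bar>" for a b c d :: real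
    by linarith
  have "\<bar>pruefer_field p q A B t x\<bar> \<le> C * 1 + C * 1 + C * 1 + C * 1"
    unfolding eq by (rule order_trans[OF sum4]) (intro add_mono mono assms sq le)
  then show "\<bar>pruefer_field p q A B t x\<bar> \<le> 4 * C" by simp
  define d where "d = \<bar>x - y\<bar>"
  have max_diff: "\<bar>max a 0 - max b 0\<bar> \<le> \<bar>a - b\<bar>" for a b :: real by (simp add: max_def)
  have sin_d: "\<bar>sin x - sin y\<bar> \<le> d" "\<bar>- sin x - - sin y\<bar> \<le> d"
    using abs_sin_diff_le[of x y] by (simp_all add: d_def abs_minus_commute)
  have cos_d: "\<bar>cos x - cos y\<bar> \<le> d" using abs_cos_diff_le by (simp add: d_def)
  have "pruefer_field p q A B t x - pruefer_field p q A B t y =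
      1 / p t * ((cos x)\<^sup>2 - (cos y)\<^sup>2) - q t * ((sin x)\<^sup>2 - (sin y)\<^sup>2) +
      A t * ((max (sin x) 0)\<^sup>2 - (max (sin y) 0)\<^sup>2) + B t * ((max (- sin x) 0)\<^sup>2 - (max (- sin y) 0)\<^sup>2)"
    unfolding eq by (simp only: right_diff_distrib)
  also have "\<bar>\<dots>\<bar> \<le> C * (2 * d) + C * (2 * d) + C * (2 * d) + C * (2 * d)"
    by (rule order_trans[OF sum4])
       (intro add_mono mono assms abs_square_diff_le le cos_d sin_d order_trans[OF max_diff])
  finally show "\<bar>pruefer_field p q A B t x - pruefer_field p q A B t y\<bar> \<le> 8 * C * \<bar>x - y\<bar>"
    by (simp add: d_def)
qed

text \<open>
  The coefficients are extended continuously beyond their domain by clamping \<open>t\<close> to \<open>[T1, T2]\<close> and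
  \<open>l\<close> to \<open>[0, \<Lambda>]\<close>, which makes the field bounded and Lipschitz uniformly.
\<close>

lemma pruefer_family:
  assumes p: "continuous_on {T1..T2} p" "\<forall>t\<in>{T1..T2}. p t > 0" and q: "continuous_on {T1..T2} q"
    and M: "continuous_on {T1..T2} M" and N: "continuous_on {T1..T2} N" and T: "T1 < T2"
    and \<Lambda>: "\<Lambda> \<ge> 0"
  shows "\<exists>\<theta>. (\<forall>l. \<theta> T1 l = 0) \<and> continuous_on UNIV (\<theta> T2) \<and>
    (\<forall>l\<in>{0..\<Lambda>}. pruefer T1 T2 p q (\<lambda>t. l * M t) (\<lambda>t. l * N t) (\<lambda>t. \<theta> t l))"
proof -
  define c where "c t = max T1 (min T2 t)" for t
  define e where "e l = max 0 (min \<Lambda> l)" for l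
  have c: "c t \<in> {T1..T2}" for t using T by (auto simp: c_def)
  have e: "e l \<in> {0..\<Lambda>}" for l using \<Lambda> by (auto simp: e_def)
  have id: "t \<in> {T1..T2} \<Longrightarrow> c t = t" "l \<in> {0..\<Lambda>} \<Longrightarrow> e l = l" for t l by (auto simp: c_def e_def)
  define g where "g t x l = pruefer_field p q (\<lambda>t. e l * M t) (\<lambda>t. e l * N t) (c t) x" for t x l
  have pnz: "p (c t) \<noteq> 0" for t using p(2) c[of t] by force
  have cc: "continuous_on UNIV (\<lambda>x::real\<times>real\<times>real. f (c (fst x)))" if "continuous_on {T1..T2} f" for f
  proof (rule continuous_on_compose2[OF that])
    show "continuous_on UNIV (\<lambda>x::real\<times>real\<times>real. c (fst x))"
      unfolding c_def by (intro continuous_intros)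
  qed (use c in auto)
  have contg: "continuous_on UNIV (\<lambda>(t, x, l). g t x l)"
    unfolding g_def split_def pruefer_field_def e_def
    by (intro continuous_intros cc p q M N) (use pnz in auto)
  have "continuous_on {T1..T2} (\<lambda>t. 1 / p t)"
    using p by (intro continuous_intros) force+
  then have "continuous_on {T1..T2} (\<lambda>t. \<bar>1 / p t\<bar> + \<bar>q t\<bar> + \<bar>\<Lambda> * M t\<bar> + \<bar>\<Lambda> * N t\<bar>)"
    by (intro continuous_on_add continuous_on_rabs continuous_on_mult_left q M N)
  then obtain C where C: "C > 0" "\<And>t. t \<in> {T1..T2} \<Longrightarrow>
      \<bar>\<bar>1 / p t\<bar> + \<bar>q t\<bar> + \<bar>\<Lambda> * M t\<bar> + \<bar>\<Lambda> * N t\<bar>\<bar> \<le> C"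
    using continuous_on_Icc_bounded by blast
  have "\<bar>e l * y\<bar> \<le> \<bar>\<Lambda> * y\<bar>" for l y
    unfolding abs_mult using e[of l] by (intro mult_right_mono) auto
  then have "\<bar>1 / p (c t)\<bar> + \<bar>q (c t)\<bar> + \<bar>e l * M (c t)\<bar> + \<bar>e l * N (c t)\<bar> \<le> C" for t l
    by (intro order_trans[OF _ abs_le_D1[OF C(2)[OF c[of t]]]] add_mono order_refl)
  moreover have "r1 \<le> C \<and> r2 \<le> C \<and> r3 \<le> C \<and> r4 \<le> C"
    if "r1 + r2 + r3 + r4 \<le> C" "0 \<le> r1" "0 \<le> r2" "0 \<le> r3" "0 \<le> r4" for r1 r2 r3 r4
    using that by linarith
  ultimately have bd: "\<bar>1 / p (c t)\<bar> \<le> C \<and> \<bar>q (c t)\<bar> \<le> C \<and> \<bar>e l * M (c t)\<bar> \<le> C \<and> \<bar>e l * N (c t)\<bar> \<le> C" for t l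
    by (meson abs_ge_zero)
  have g: "\<bar>g t x l\<bar> \<le> 4 * C" "\<bar>g t x l - g t y l\<bar> \<le> 8 * C * \<bar>x - y\<bar>" for t x y l
    unfolding g_def by (rule pruefer_field_bounded_Lipschitz; use bd[of t l] in simp)+
  have "8 * C > 0" "T1 \<le> T2" using C T by auto
  then obtain \<theta> where \<theta>: "\<And>l. \<theta> T1 l = 0" "continuous_on UNIV (\<theta> T2)"
    "\<And>t l. t \<in> {T1..T2} \<Longrightarrow>
       ((\<lambda>t. \<theta> t l) has_real_derivative g t (\<theta> t l) l) (at t within {T1..T2})"
    using picard_parameter[of g "4 * C" "8 * C" T1 T2 0, OF contg g] by metis
  have "pruefer T1 T2 p q (\<lambda>t. l * M t) (\<lambda>t. l * N t) (\<lambda>t. \<theta> t l)" if "l \<in> {0..\<Lambda>}" for l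
  proof -
    have "e l = l" using id(2)[OF that] .
    then show ?thesis unfolding pruefer_def using \<theta>(3)[of _ l] by (auto simp: g_def id(1))
  qed
  with \<theta> show ?thesis by blast
qed

section \<open>Nonempty sets and alternation\<close>

text \<open>
  Shooting: the final angle is a continuous function of \<open>l\<close>, is at least \<open>k \<pi>\<close> for large \<open>l\<close>, and is below
  \<open>\<pi>\<close> for \<open>l = 0\<close>.  The latter holds because reaching \<open>\<pi>\<close> with vanishing weights would produce a positive arch that
  \<open>solution_alternates\<close> excludes.
\<close>

lemma alternates_imp_solution:
  assumes p: "continuous_on {T1..T2} p" "\<forall>t\<in>{T1..T2}. p t > 0"
    and q: "continuous_on {T1..T2} q" "\<forall>t\<in>{T1..T2}. q t \<ge> 0"
    and M: "continuous_on {T1..T2} M" and N: "continuous_on {T1..T2} N" and T: "T1 < T2"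
    and k: "k \<ge> 1" and alt: "alternates (\<lambda>t. M t > 0) (\<lambda>t. N t > 0) T1 T2 k"
  shows "\<exists>l>0. \<exists>u u'. is_solution T1 T2 p q (\<lambda>t. l * M t) (\<lambda>t. l * N t) 1 1 u u' \<and>
    has_zeros T1 T2 u (k - 1) \<and> u' T1 > 0"
proof -
  obtain \<Lambda>0 where \<Lambda>0: "\<And>l \<theta>. l \<ge> \<Lambda>0 \<Longrightarrow> pruefer T1 T2 p q (\<lambda>t. l * M t) (\<lambda>t. l * N t) \<theta> \<Longrightarrow>
      \<theta> T1 \<ge> 0 \<Longrightarrow> \<theta> T2 \<ge> k * pi"
    using pruefer_large[OF p q(1) M N _ _ alt] T by auto
  define \<Lambda> where "\<Lambda> = max 0 \<Lambda>0"
  have \<Lambda>: "\<Lambda> \<ge> 0" by (simp add: \<Lambda>_def)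
  obtain \<theta> where \<theta>: "\<And>l. \<theta> T1 l = 0" "continuous_on UNIV (\<theta> T2)"
    "\<And>l. l \<in> {0..\<Lambda>} \<Longrightarrow> pruefer T1 T2 p q (\<lambda>t. l * M t) (\<lambda>t. l * N t) (\<lambda>t. \<theta> t l)"
    using pruefer_family[OF p q(1) M N T \<Lambda>] by metis
  have upper: "\<theta> T2 \<Lambda> \<ge> k * pi"
    using \<Lambda>0[OF _ \<theta>(3)[of \<Lambda>]] \<Lambda> by (simp add: \<theta>(1) \<Lambda>_def)
  \<comment> \<open>The necessity part, applied up to a time at which the angle would be \<open>\<pi>\<close>.\<close>
  have lower: "\<theta> T2 0 < pi"
  proof (rule ccontr)
    assume "\<not> \<theta> T2 0 < pi"
    moreover have pr0: "pruefer T1 T2 p q (\<lambda>_. 0) (\<lambda>_. 0) (\<lambda>t. \<theta> t 0)" using \<theta>(3)[of 0] \<Lambda> by simp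
    ultimately have "\<exists>t\<ge>T1. t \<le> T2 \<and> \<theta> t 0 = pi"
      using T by (intro IVT' pruefer_continuous[OF pr0]) (auto simp: \<theta>(1))
    then obtain t where t: "T1 \<le> t" "t \<le> T2" "\<theta> t 0 = pi" by blast
    have "T1 < t" using t \<theta>(1)[of 0] by (cases "t = T1") auto
    have sub: "{T1..t} \<subseteq> {T1..T2}" using t by auto
    have pr: "pruefer T1 t p q (\<lambda>_. 0) (\<lambda>_. 0) (\<lambda>t. \<theta> t 0)"
      using pr0 sub unfolding pruefer_def by (meson DERIV_subset subsetD)
    have pq: "continuous_on {T1..t} p" "\<forall>t\<in>{T1..t}. p t > 0" "continuous_on {T1..t} q" "\<forall>t\<in>{T1..t}. q t \<ge> 0"
      using p q sub by (auto intro: continuous_on_subset)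
    obtain u u' where u: "is_solution T1 t p q (\<lambda>_. 0) (\<lambda>_. 0) 1 1 u u'" "has_zeros T1 t u (1 - 1)" "u' T1 > 0"
      using pruefer_solution[OF pq(1-3) _ _ \<open>T1 < t\<close> pr \<theta>(1), of 1] t(3) by auto
    then have "alternates (\<lambda>t. 1 * 0 > (0::real)) (\<lambda>t. 1 * 0 > (0::real)) T1 t (Suc (1 - 1))"
      using \<open>T1 < t\<close> pq
      by (intro solution_alternates[OF u(1)]) (auto simp: has_zeros_def is_solution_def)
    then show False by simp
  qed
  also have "pi \<le> k * pi" using k by simp
  finally have lower: "\<theta> T2 0 < k * pi" .
  have "\<exists>l\<ge>0. l \<le> \<Lambda> \<and> \<theta> T2 l = k * pi"
    using upper lower \<Lambda> by (intro IVT' continuous_on_subset[OF \<theta>(2)]) auto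
  then obtain l where l: "0 \<le> l" "l \<le> \<Lambda>" "\<theta> T2 l = k * pi" by blast
  have prl: "pruefer T1 T2 p q (\<lambda>t. l * M t) (\<lambda>t. l * N t) (\<lambda>t. \<theta> t l)"
    using \<theta>(3) l by simp
  have "l > 0" using l lower by (cases "l = 0") auto
  moreover obtain u u' where "is_solution T1 T2 p q (\<lambda>t. l * M t) (\<lambda>t. l * N t) 1 1 u u'"
    "has_zeros T1 T2 u (k - 1)" "u' T1 > 0"
    using pruefer_solution[OF p q(1) continuous_on_mult_left[OF M] continuous_on_mult_left[OF N] T prl \<theta>(1) l(3)]
    by blast
  ultimately show ?thesis by blast
qed

text \<open>
  The numbers \<open>\<sigma>\<close> and \<open>\<tau>\<close> are the signs of the coefficients in the quadrant; restricted to the ray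
  \<open>(a, b) = (l \<sigma>, l \<tau>)\<close> the two-parameter problem has the single parameter \<open>l\<close>.
\<close>

lemma C_gt_quadrant_iff:
  assumes p: "continuous_on {T1..T2} p" "\<forall>t\<in>{T1..T2}. p t > 0"
    and q: "continuous_on {T1..T2} q" "\<forall>t\<in>{T1..T2}. q t \<ge> 0"
    and m: "continuous_on {T1..T2} m" and n: "continuous_on {T1..T2} n" and T: "T1 < T2"
    and k: "k \<ge> 1" and \<sigma>: "\<sigma> = 1 \<or> \<sigma> = -1" and \<tau>: "\<tau> = 1 \<or> \<tau> = -1"
  shows "C_gt T1 T2 p q m n k \<inter> {a. \<sigma> * a > 0} \<times> {b. \<tau> * b > 0} \<noteq> {} \<longleftrightarrow>
    alternates (\<lambda>t. \<sigma> * m t > 0) (\<lambda>t. \<tau> * n t > 0) T1 T2 k"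
proof
  assume "C_gt T1 T2 p q m n k \<inter> {a. \<sigma> * a > 0} \<times> {b. \<tau> * b > 0} \<noteq> {}"
  then obtain a b u u' where *: "\<sigma> * a > 0" "\<tau> * b > 0" "is_solution T1 T2 p q m n a b u u'"
    "has_zeros T1 T2 u (k - 1)" "u' T1 > 0" by (auto simp: C_gt_def)
  then have "alternates (\<lambda>t. a * m t > 0) (\<lambda>t. b * n t > 0) T1 T2 (Suc (k - 1))"
    using T by (intro solution_alternates[OF *(3) p q m n]) (auto simp: has_zeros_def is_solution_def)
  moreover have "(\<lambda>t. a * m t > 0) = (\<lambda>t. \<sigma> * m t > 0)" "(\<lambda>t. b * n t > 0) = (\<lambda>t. \<tau> * n t > 0)"
    using * \<sigma> \<tau> by (auto simp: zero_less_mult_iff mult_less_0_iff)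
  ultimately show "alternates (\<lambda>t. \<sigma> * m t > 0) (\<lambda>t. \<tau> * n t > 0) T1 T2 k" using k by simp
next
  assume "alternates (\<lambda>t. \<sigma> * m t > 0) (\<lambda>t. \<tau> * n t > 0) T1 T2 k"
  then obtain l u u' where *: "l > 0"
    "is_solution T1 T2 p q (\<lambda>t. l * (\<sigma> * m t)) (\<lambda>t. l * (\<tau> * n t)) 1 1 u u'"
    "has_zeros T1 T2 u (k - 1)" "u' T1 > 0"
    using alternates_imp_solution[OF p q continuous_on_mult_left[OF m] continuous_on_mult_left[OF n] T k]
    by blast
  then have "is_solution T1 T2 p q m n (l * \<sigma>) (l * \<tau>) u u'"
    by (simp add: is_solution_def mult.assoc)
  moreover have "\<sigma> * (l * \<sigma>) > 0" "\<tau> * (l * \<tau>) > 0" using *(1) \<sigma> \<tau> by auto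
  ultimately show "C_gt T1 T2 p q m n k \<inter> {a. \<sigma> * a > 0} \<times> {b. \<tau> * b > 0} \<noteq> {}"
    using * by (auto simp: C_gt_def)
qed

text \<open>
  Passing from \<open>u\<close> to \<open>-u\<close> exchanges the two weights and the two coefficients.
\<close>

lemma C_lt_iff_C_gt: "(a, b) \<in> C_lt T1 T2 p q m n k \<longleftrightarrow> (b, a) \<in> C_gt T1 T2 p q n m k"
proof
  assume "(a, b) \<in> C_lt T1 T2 p q m n k"
  then obtain u u' where u: "is_solution T1 T2 p q m n a b u u'" "has_zeros T1 T2 u (k - 1)" "u' T1 < 0"
    by (auto simp: C_lt_def)
  have "has_zeros T1 T2 (\<lambda>t. - u t) (k - 1)" "- u' T1 > 0" using u by (simp_all add: has_zeros_def)
  with is_solution_uminus[OF u(1)] show "(b, a) \<in> C_gt T1 T2 p q n m k"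
    unfolding C_gt_def mem_Collect_eq prod.case by (intro exI conjI)
next
  assume "(b, a) \<in> C_gt T1 T2 p q n m k"
  then obtain u u' where u: "is_solution T1 T2 p q n m b a u u'" "has_zeros T1 T2 u (k - 1)" "u' T1 > 0"
    by (auto simp: C_gt_def)
  have "has_zeros T1 T2 (\<lambda>t. - u t) (k - 1)" "- u' T1 < 0" using u by (simp_all add: has_zeros_def)
  with is_solution_uminus[OF u(1)] show "(a, b) \<in> C_lt T1 T2 p q m n k"
    unfolding C_lt_def mem_Collect_eq prod.case by (intro exI conjI)
qed

lemma ecard_indices: "ecard {k. k \<ge> 2 \<and> enat k \<le> eSuc K} = K"
proof (cases K)
  case (enat j)
  then have "{k. k \<ge> 2 \<and> enat k \<le> eSuc K} = {2..Suc j}" by (auto simp: eSuc_enat)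
  then show ?thesis using enat by (simp add: ecard_def)
next
  case infinity
  then have "{k. k \<ge> 2 \<and> enat k \<le> eSuc K} = {2..}" by auto
  then show ?thesis using infinity by (simp add: ecard_def infinite_Ici)
qed

text \<open>
  As the index \<open>k = 1\<close> is not counted, the lengths \<open>K + 2\<close> and \<open>K + 1\<close> contribute \<open>K + 1\<close> and \<open>K\<close>
  nonempty sets.
\<close>

lemma num_nonempty_quadrant:
  assumes pq: "continuous_on {T1..T2} p" "\<forall>t\<in>{T1..T2}. p t > 0"
    "continuous_on {T1..T2} q" "\<forall>t\<in>{T1..T2}. q t \<ge> 0"
    and m: "continuous_on {T1..T2} m" and n: "continuous_on {T1..T2} n" and T: "T1 < T2"
    and \<sigma>: "\<sigma> = 1 \<or> \<sigma> = -1" and \<tau>: "\<tau> = 1 \<or> \<tau> = -1"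
    and x: "\<And>k. alternates (\<lambda>t. \<sigma> * m t > 0) (\<lambda>t. \<tau> * n t > 0) T1 T2 k \<longleftrightarrow> enat k \<le> x"
    and y: "\<And>k. alternates (\<lambda>t. \<tau> * n t > 0) (\<lambda>t. \<sigma> * m t > 0) T1 T2 k \<longleftrightarrow> enat k \<le> y"
    and xy: "{x, y} = {eSuc K, eSuc (eSuc K)}"
  shows "num_nonempty T1 T2 p q m n ({a. \<sigma> * a > 0} \<times> {b. \<tau> * b > 0}) = 2 * K + 1"
proof -
  let ?Q = "{a. \<sigma> * a > 0} \<times> {b. \<tau> * b > 0}" and ?Q' = "{b. \<tau> * b > 0} \<times> {a. \<sigma> * a > 0}"
  have gt: "{k. k \<ge> 2 \<and> C_gt T1 T2 p q m n k \<inter> ?Q \<noteq> {}} = {k. k \<ge> 2 \<and> enat k \<le> x}"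
    by (intro Collect_cong conj_cong refl) (subst C_gt_quadrant_iff[OF pq m n T _ \<sigma> \<tau>]; simp add: x)
  have swap: "C_lt T1 T2 p q m n k \<inter> ?Q \<noteq> {} \<longleftrightarrow> C_gt T1 T2 p q n m k \<inter> ?Q' \<noteq> {}" for k
    using C_lt_iff_C_gt[of _ _ T1 T2 p q m n k] by fast
  have lt: "{k. k \<ge> 2 \<and> C_lt T1 T2 p q m n k \<inter> ?Q \<noteq> {}} = {k. k \<ge> 2 \<and> enat k \<le> y}"
    by (intro Collect_cong conj_cong refl) (subst swap, subst C_gt_quadrant_iff[OF pq n m T _ \<tau> \<sigma>]; simp add: y)
  have "num_nonempty T1 T2 p q m n ?Q = ecard {k. k \<ge> 2 \<and> enat k \<le> x} + ecard {k. k \<ge> 2 \<and> enat k \<le> y}"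
    unfolding num_nonempty_def gt lt ..
  moreover have "K + eSuc K = 2 * K + 1" "eSuc K + K = 2 * K + 1"
    by (simp_all add: mult_2 iadd_Suc iadd_Suc_right plus_1_eSuc)
  ultimately show ?thesis using xy by (auto simp: doubleton_eq_iff ecard_indices)
qed

section \<open>Words with prescribed alternations\<close>

text \<open>
  Words are laid out on the line, one unit cell for each letter.  The cells are open because the weights
  built from a word vanish at the integers.
\<close>

definition occurs :: "('a \<Rightarrow> bool) \<Rightarrow> 'a list \<Rightarrow> real \<Rightarrow> bool" where
  "occurs P w t \<longleftrightarrow> (\<exists>i < length w. real i < t \<and> t < real i + 1 \<and> P (w ! i))"

text \<open>
  The maximal number of alternations read off the word, beginning with a letter satisfying \<open>P\<close>.  The
  greedy choice of points is optimal.  A letter satisfying both predicates allows arbitrarily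
  many alternations inside its own cell.
\<close>

fun alt_len :: "('a \<Rightarrow> bool) \<Rightarrow> ('a \<Rightarrow> bool) \<Rightarrow> 'a list \<Rightarrow> enat" where
  "alt_len P Q [] = 0"
| "alt_len P Q (x # w) =
     (if P x then if Q x then \<infinity> else eSuc (alt_len Q P w) else alt_len P Q w)"

lemma occurs_Cons: "occurs P (x # w) t \<longleftrightarrow> (0 < t \<and> t < 1 \<and> P x) \<or> occurs P w (t - 1)"
proof
  assume "occurs P (x # w) t"
  then obtain i where i: "i < Suc (length w)" "real i < t" "t < real i + 1" "P ((x # w) ! i)"
    by (auto simp: occurs_def)
  then show "(0 < t \<and> t < 1 \<and> P x) \<or> occurs P w (t - 1)"
  proof (cases i)
    case (Suc j)
    with i have "occurs P w (t - 1)" unfolding occurs_def by (intro exI[of _ j]) auto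
    then show ?thesis ..
  qed auto
next
  assume "(0 < t \<and> t < 1 \<and> P x) \<or> occurs P w (t - 1)"
  then show "occurs P (x # w) t"
  proof
    assume "0 < t \<and> t < 1 \<and> P x"
    then show ?thesis by (auto simp: occurs_def intro!: exI[of _ 0])
  next
    assume "occurs P w (t - 1)"
    then obtain i where i: "i < length w" "real i < t - 1" "t - 1 < real i + 1" "P (w ! i)"
      by (auto simp: occurs_def)
    then show ?thesis unfolding occurs_def by (intro exI[of _ "Suc i"]) auto
  qed
qed

lemma occurs_nonpos: "t \<le> 0 \<Longrightarrow> \<not> occurs P w t"
  by (auto simp: occurs_def)

text \<open>
  The first cell is handled greedily: if it can supply a point, its midpoint is as good as any other; and if
  it satisfies only one of the predicates it supplies at most one useful point.
\<close>

lemma alternates_occurs: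
  "alternates (occurs P w) (occurs Q w) 0 (length w) k \<longleftrightarrow> enat k \<le> alt_len P Q w"
proof (induction w arbitrary: P Q k)
  case Nil
  show ?case by (cases k) (auto simp: occurs_def enat_0_iff)
next
  case (Cons x w)
  let ?O = "\<lambda>P. occurs P (x # w)" and ?T = "real (length (x # w))"
  have tail: "alternates (?O P) (?O Q) 1 ?T k \<longleftrightarrow> enat k \<le> alt_len P Q w" for P Q k
  proof -
    have "alternates (?O P) (?O Q) (1 + 1 * 0) (1 + 1 * real (length w)) k \<longleftrightarrow>
          alternates (\<lambda>t. ?O P (1 + 1 * t)) (\<lambda>t. ?O Q (1 + 1 * t)) 0 (length w) k"
      by (rule alternates_affine) simp
    also have "\<dots> \<longleftrightarrow> alternates (occurs P w) (occurs Q w) 0 (length w) k"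
      by (rule alternates_cong) (auto simp: occurs_Cons)
    finally show ?thesis by (simp add: Cons.IH)
  qed
  have skip: "alternates (?O P) (?O Q) 0 ?T k \<longleftrightarrow> enat k \<le> alt_len P Q w" if "\<not> P x" for P Q k
    unfolding tail[symmetric] using that
    by (intro alternates_skip) (auto simp: occurs_Cons occurs_nonpos)
  show ?case
  proof (cases "P x")
    case False
    then show ?thesis using skip[where P=P and Q=Q and k=k] by simp
  next
    case Px: True
    show ?thesis
    proof (cases "Q x")
      case True
      then have "alternates (?O P) (?O Q) 0 ?T k" using Px
        by (intro alternates_both[of 0 1]) (auto simp: occurs_Cons)
      then show ?thesis using Px True by simp
    next
      case False
      have "alternates (?O P) (?O Q) 0 ?T (Suc j) \<longleftrightarrow> enat j \<le> alt_len Q P w" for j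
      proof
        assume "alternates (?O P) (?O Q) 0 ?T (Suc j)"
        then obtain t where "0 < t" "alternates (?O Q) (?O P) t ?T j" by auto
        then have "alternates (?O Q) (?O P) 0 ?T j" by (meson alternates_mono less_imp_le)
        then show "enat j \<le> alt_len Q P w" using skip False by blast
      next
        assume "enat j \<le> alt_len Q P w"
        then have "alternates (?O Q) (?O P) 1 ?T j" using tail by blast
        then have "alternates (?O Q) (?O P) (1/2) ?T j" by (rule alternates_mono) simp
        moreover have "?O P (1/2)" using Px by (simp add: occurs_Cons)
        ultimately show "alternates (?O P) (?O Q) 0 ?T (Suc j)"
          by (auto intro!: exI[of _ "1/2"])
      qed
      then show ?thesis using Px False
        by (cases k) (simp_all add: eSuc_enat[symmetric] zero_enat_def[symmetric] del: alternates.simps(2))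
    qed
  qed
qed

text \<open>
  The coefficients of \<open>m\<close> and of \<open>n\<close> on one cell.
\<close>

type_synonym letter = "real \<times> real"

definition even_part :: "enat \<Rightarrow> enat" where
  "even_part K = (if K = \<infinity> then \<infinity> else enat (2 * (the_enat K div 2)))"

definition odd_enat :: "enat \<Rightarrow> bool" where "odd_enat K \<longleftrightarrow> (\<exists>k. odd k \<and> K = enat k)"

lemma even_part_plus_parity: "even_part K + (if odd_enat K then 1 else 0) = K"
proof (cases K)
  case (enat k)
  then show ?thesis by (auto simp: even_part_def odd_enat_def one_enat_def elim: oddE)
qed (simp add: even_part_def odd_enat_def)

text \<open>
  A block contributing the even part of \<open>K\<close> to the alternations between \<open>x\<close> and \<open>y\<close>.  An infinite
  contribution is made by the single letter \<open>x + y\<close>, at which both letters are present at once.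
\<close>

definition zigzag :: "letter \<Rightarrow> letter \<Rightarrow> enat \<Rightarrow> letter list" where
  "zigzag x y K = (if K = \<infinity> then [x + y] else concat (replicate (the_enat K div 2) [x, y]))"

text \<open>
  This holds if the first letter of \<open>w\<close> satisfying \<open>P\<close> or \<open>Q\<close> satisfies only \<open>P\<close>, and also if both
  lengths are infinite.  Then putting further letters that satisfy only \<open>P\<close> in front of \<open>w\<close> changes
  neither length; this is how a block leaves the other pairs alone.
\<close>

definition leads where "leads P Q w \<longleftrightarrow> alt_len P Q w = eSuc (alt_len Q P w)"

lemma eSuc_add: "eSuc m + n = eSuc (m + n)" "m + eSuc n = eSuc (m + n)"
  by (simp_all add: iadd_Suc iadd_Suc_right)

text \<open>
  As \<open>P\<close> leads the rest of the word, the last letter \<open>y\<close> of the block is again followed by the class of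
  \<open>x\<close>, so no alternation is lost at the seam, whichever class one starts with.
\<close>

lemma alt_len_zigzag_own_pair:
  assumes "P x" "\<not> Q x" "Q y" "\<not> P y" "P (x + y)" "Q (x + y)" "leads P Q w"
  shows "alt_len P Q (zigzag x y K @ w) = even_part K + alt_len P Q w"
    and "alt_len Q P (zigzag x y K @ w) = even_part K + alt_len Q P w"
proof -
  have 1: "alt_len P Q (concat (replicate i [x, y]) @ w) = enat (2 * i) + alt_len P Q w \<and>
        alt_len Q P (concat (replicate i [x, y]) @ w) = enat (2 * i) + alt_len Q P w" for i
  proof (induction i)
    case 0 then show ?case by (simp add: zero_enat_def[symmetric])
  next
    case (Suc i)
    then show ?case using assms by (simp add: leads_def eSuc_enat[symmetric] eSuc_add)
  qed
  show "alt_len P Q (zigzag x y K @ w) = even_part K + alt_len P Q w"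
    "alt_len Q P (zigzag x y K @ w) = even_part K + alt_len Q P w"
    using 1[of "the_enat K div 2"] assms by (auto simp: zigzag_def even_part_def)
qed

text \<open>
  Letters satisfying neither predicate are skipped, and the other ones repeat the class that comes next
  anyway.
\<close>

lemma alt_len_zigzag_absorbed:
  assumes "P x \<and> \<not> P y \<or> P y \<and> \<not> P x" "\<not> Q x" "\<not> Q y" "P (x + y)" "\<not> Q (x + y)" "leads P Q w"
  shows "alt_len P Q (zigzag x y K @ w) = alt_len P Q w"
    and "alt_len Q P (zigzag x y K @ w) = alt_len Q P w"
proof -
  have 1: "alt_len P Q (concat (replicate i [x, y]) @ w) = alt_len P Q w \<and>
        alt_len Q P (concat (replicate i [x, y]) @ w) = alt_len Q P w" for i
    by (induction i) (use assms in \<open>auto simp: leads_def\<close>)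
  show "alt_len P Q (zigzag x y K @ w) = alt_len P Q w"
    "alt_len Q P (zigzag x y K @ w) = alt_len Q P w"
    using 1[of "the_enat K div 2"] assms by (auto simp: zigzag_def leads_def)
qed

lemma alt_len_zigzag_foreign:
  assumes "\<not> P x" "\<not> P y" "\<not> Q x" "\<not> Q y" "\<not> P (x + y)" "\<not> Q (x + y)"
  shows "alt_len P Q (zigzag x y K @ w) = alt_len P Q w"
proof -
  have "alt_len P Q (concat (replicate i [x, y]) @ w) = alt_len P Q w" for i
    by (induction i) (use assms in auto)
  then show ?thesis using assms by (auto simp: zigzag_def)
qed

text \<open>
  Both starting classes are recorded, in unspecified order: the two maximal lengths differ by one,
  and which of them is larger depends on which class comes first in the word.
\<close>

definition alternation_profile ::
  "letter list \<Rightarrow> enat \<Rightarrow> enat \<Rightarrow> enat \<Rightarrow> enat \<Rightarrow> bool" where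
  "alternation_profile w K L M N \<longleftrightarrow>
   {alt_len (\<lambda>x. fst x > 0) (\<lambda>x. snd x > 0) w, alt_len (\<lambda>x. snd x > 0) (\<lambda>x. fst x > 0) w} = {eSuc K, eSuc (eSuc K)} \<and>
   {alt_len (\<lambda>x. fst x < 0) (\<lambda>x. snd x < 0) w, alt_len (\<lambda>x. snd x < 0) (\<lambda>x. fst x < 0) w} = {eSuc L, eSuc (eSuc L)} \<and>
   {alt_len (\<lambda>x. fst x > 0) (\<lambda>x. snd x < 0) w, alt_len (\<lambda>x. snd x < 0) (\<lambda>x. fst x > 0) w} = {eSuc M, eSuc (eSuc M)} \<and>
   {alt_len (\<lambda>x. fst x < 0) (\<lambda>x. snd x > 0) w, alt_len (\<lambda>x. snd x > 0) (\<lambda>x. fst x < 0) w} = {eSuc N, eSuc (eSuc N)}"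

definition letter_if where "letter_if b x = (if b then [x] else [])"

lemma letter_if_simps: "letter_if True x = [x]" "letter_if False x = []"
  by (auto simp: letter_if_def)

abbreviation "m_pos \<equiv> (1::real,0::real)"
abbreviation "n_pos \<equiv> (0::real,1::real)"
abbreviation "m_neg \<equiv> (-1::real,0::real)"
abbreviation "n_neg \<equiv> (0::real,-1::real)"

lemma even_part_eq: "odd_enat K \<Longrightarrow> eSuc (even_part K) = K" "\<not> odd_enat K \<Longrightarrow> even_part K = K"
  using even_part_plus_parity[of K] by (auto simp: plus_1_eSuc)

text \<open>
  The blocks belong to the edges of the path \<open>m > 0\<close> -- \<open>n > 0\<close> -- \<open>m < 0\<close> -- \<open>n < 0\<close>.  Each is placed so
  that in the rest of the word its first letter leads for its own pair, and each of its letters leads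
  for the neighbouring pair that it also concerns.  Hence it lengthens only its own pair, by an even or infinite
  number.  Odd numbers are attained by one more letter at an end of the word, which affects a single
  pair.  The pair \<open>m > 0, n < 0\<close>, which closes the path to a cycle, keeps the minimal length \<open>2\<close>.
\<close>

lemma alternation_profile_path_word:
  "alternation_profile
     (letter_if (odd_enat N) m_neg @ letter_if (odd_enat K) n_pos @
      zigzag m_pos n_pos K @ m_pos # zigzag n_pos m_neg N @ n_pos #
      zigzag m_neg n_neg L @ m_neg # n_neg #
      letter_if (odd_enat L) m_neg)
     K L 0 N"
  unfolding alternation_profile_def
  by (cases "odd_enat K"; cases "odd_enat L"; cases "odd_enat N")
   (simp_all add: letter_if_simps alt_len_zigzag_own_pair alt_len_zigzag_absorbed
      alt_len_zigzag_foreign leads_def eSuc_add even_part_eq insert_commute)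

text \<open>
  Closing the cycle needs a return from \<open>n < 0\<close> to \<open>m > 0\<close>.  The final letter \<open>m > 0\<close> of that
  return follows all letters \<open>n > 0\<close>, and so adds one alternation to the first pair as well.  This
  is why the first and the third number are both positive here.
\<close>

lemma alternation_profile_cycle_word:
  "alternation_profile
     (letter_if (odd_enat N) m_neg @ letter_if (odd_enat K) n_pos @
      zigzag m_pos n_pos K @ m_pos # zigzag n_pos m_neg N @ n_pos #
      zigzag m_neg n_neg L @ m_neg # zigzag n_neg m_pos M @ n_neg # m_pos #
      letter_if (odd_enat M) n_neg @ letter_if (odd_enat L) m_neg)
     (eSuc K) L (eSuc M) N"
  unfolding alternation_profile_def
  by (cases "odd_enat K"; cases "odd_enat L"; cases "odd_enat N"; cases "odd_enat M")
   (simp_all add: letter_if_simps alt_len_zigzag_own_pair alt_len_zigzag_absorbed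
      alt_len_zigzag_foreign leads_def eSuc_add even_part_eq insert_commute)

lemma alt_len_map: "alt_len P Q (map f w) = alt_len (\<lambda>x. P (f x)) (\<lambda>x. Q (f x)) w"
  by (induction w arbitrary: P Q) auto

text \<open>
  If \<open>K = 0\<close>, negating the second weight exchanges the roles of \<open>K\<close> and \<open>M\<close> (and of \<open>L\<close> and \<open>N\<close>), which
  reduces to the word for \<open>M = 0\<close>.
\<close>

lemma word_exists: "\<exists>w::letter list. alternation_profile w K L M N"
proof -
  have neg: "alternation_profile (map (\<lambda>x. (fst x, - snd x)) w) M N K L"
    if "alternation_profile w K L M N" for K L M N and w :: "letter list"
    using that by (simp add: alternation_profile_def alt_len_map)
  consider "M = 0" | "K = 0" | K' M' where "K = eSuc K'" "M = eSuc M'"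
    by (metis enat.exhaust not0_implies_Suc zero_enat_def eSuc_enat eSuc_infinity)
  then show ?thesis
    by cases (use alternation_profile_path_word alternation_profile_cycle_word neg in blast)+
qed

section \<open>Weights from words\<close>

text \<open>
  The tents vanish at the ends of their cells, so the sum is continuous and shows on each cell the sign of
  that cell's coefficient.
\<close>

fun bumps :: "real list \<Rightarrow> real \<Rightarrow> real" where
  "bumps [] s = 0"
| "bumps (c # cs) s = c * max 0 (1/2 - \<bar>s - 1/2\<bar>) + bumps cs (s - 1)"

lemma continuous_on_bumps: "continuous_on S f \<Longrightarrow> continuous_on S (\<lambda>x. bumps cs (f x))"
  for f :: "'a::topological_space \<Rightarrow> real"
proof (induction cs arbitrary: f)
  case (Cons c cs)
  have "continuous_on S (\<lambda>x. bumps cs (f x - 1))"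
    by (intro Cons.IH continuous_on_diff Cons.prems continuous_on_const)
  then show ?case unfolding bumps.simps by (intro continuous_intros Cons.prems)
qed simp

lemma bumps_nonpos: "s \<le> 0 \<Longrightarrow> bumps cs s = 0"
proof (induction cs arbitrary: s)
  case (Cons c cs)
  have "1/2 - \<bar>s - 1/2\<bar> \<le> 0" using Cons.prems by linarith
  then show ?case using Cons by simp
qed simp

lemma bumps_sign:
  "(bumps cs s > 0 \<longleftrightarrow> occurs (\<lambda>c. c > 0) cs s) \<and> (bumps cs s < 0 \<longleftrightarrow> occurs (\<lambda>c. c < 0) cs s)"
proof (induction cs arbitrary: s)
  case (Cons c cs)
  consider "s \<le> 0" | "0 < s" "s < 1" | "s \<ge> 1" by linarith
  then show ?case
  proof cases
    case 2
    define h where "h = max 0 (1/2 - \<bar>s - 1/2\<bar>)"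
    have "1/2 - \<bar>s - 1/2\<bar> > 0" using 2 by linarith
    then have "h > 0" by (simp add: h_def)
    moreover have "bumps (c # cs) s = c * h" using 2 by (simp add: h_def bumps_nonpos)
    ultimately show ?thesis
      using 2 by (simp add: occurs_Cons occurs_nonpos zero_less_mult_iff mult_less_0_iff)
  next
    case 3
    have "1/2 - \<bar>s - 1/2\<bar> \<le> 0" using 3 by linarith
    then have "bumps (c # cs) s = bumps cs (s - 1)" by simp
    then show ?thesis using 3 Cons by (simp add: occurs_Cons)
  qed (auto simp: bumps_nonpos occurs_nonpos)
qed (auto simp: occurs_def)

lemma occurs_map: "occurs P (map f w) = occurs (\<lambda>x. P (f x)) w"
  by (rule ext) (auto simp: occurs_def)

lemma alternates_rescaled:
  assumes T: "T1 < T2" and w: "w \<noteq> []"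
  shows "alternates (\<lambda>t. occurs P w ((t - T1) / (T2 - T1) * length w))
            (\<lambda>t. occurs Q w ((t - T1) / (T2 - T1) * length w)) T1 T2 k \<longleftrightarrow> enat k \<le> alt_len P Q w"
proof -
  define d where "d = (T2 - T1) / length w"
  have d: "d > 0" "d * length w = T2 - T1" using T w by (auto simp: d_def)
  have "(T1 + d * t - T1) / (T2 - T1) * length w = t" for t using T w by (simp add: d_def)
  then show ?thesis
    using alternates_affine[OF d(1), of "\<lambda>t. occurs P w ((t - T1) / (T2 - T1) * length w)"
      "\<lambda>t. occurs Q w ((t - T1) / (T2 - T1) * length w)" T1 0 "length w" k] d(2)
    by (simp add: alternates_occurs)
qed

theorem proposition3p12:
  fixes T1 T2 :: real and p q :: "real \<Rightarrow> real" and K L M N :: enat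
  assumes "T1 < T2"
    and "continuous_on {T1..T2} p" and "continuous_on {T1..T2} q"
    and "\<forall>t\<in>{T1..T2}. p t > 0" and "\<forall>t\<in>{T1..T2}. q t \<ge> 0"
  shows "\<exists>m n :: real \<Rightarrow> real.
           continuous_on {T1..T2} m \<and> continuous_on {T1..T2} n \<and>
           changes_sign T1 T2 m \<and> changes_sign T1 T2 n \<and>
           num_nonempty T1 T2 p q m n ({0<..} \<times> {0<..}) = 2 * K + 1 \<and>
           num_nonempty T1 T2 p q m n ({..<0} \<times> {..<0}) = 2 * L + 1 \<and>
           num_nonempty T1 T2 p q m n ({0<..} \<times> {..<0}) = 2 * M + 1 \<and>
           num_nonempty T1 T2 p q m n ({..<0} \<times> {0<..}) = 2 * N + 1"
proof -
  obtain w :: "letter list" where w: "alternation_profile w K L M N" using word_exists by blast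
  then have "w \<noteq> []" by (auto simp: alternation_profile_def doubleton_eq_iff)
  note T = assms(1) and pq = assms(2,4,3,5)
  define s where "s t = (t - T1) / (T2 - T1) * length w" for t
  define m where "m t = bumps (map fst w) (s t)" for t
  define n where "n t = bumps (map snd w) (s t)" for t
  have "continuous_on {T1..T2} s" unfolding s_def using T by (auto intro!: continuous_intros)
  then have m: "continuous_on {T1..T2} m" and n: "continuous_on {T1..T2} n"
    unfolding m_def n_def by (intro continuous_on_bumps; simp)+
  have sgn: "m t > 0 \<longleftrightarrow> occurs (\<lambda>x. fst x > 0) w (s t)" "m t < 0 \<longleftrightarrow> occurs (\<lambda>x. fst x < 0) w (s t)"
    "n t > 0 \<longleftrightarrow> occurs (\<lambda>x. snd x > 0) w (s t)" "n t < 0 \<longleftrightarrow> occurs (\<lambda>x. snd x < 0) w (s t)" for t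
    unfolding m_def n_def by (simp_all add: bumps_sign occurs_map)
  have sign: "0 < 1 * x \<longleftrightarrow> 0 < x" "0 < - 1 * x \<longleftrightarrow> x < 0" for x :: real by simp_all
  note alt = alternates_rescaled[OF T \<open>w \<noteq> []\<close>, folded s_def]
  note num = num_nonempty_quadrant[OF pq m n T]
  have lens:
    "{alt_len (\<lambda>x. fst x > 0) (\<lambda>x. snd x > 0) w, alt_len (\<lambda>x. snd x > 0) (\<lambda>x. fst x > 0) w} = {eSuc K, eSuc (eSuc K)}"
    "{alt_len (\<lambda>x. fst x < 0) (\<lambda>x. snd x < 0) w, alt_len (\<lambda>x. snd x < 0) (\<lambda>x. fst x < 0) w} = {eSuc L, eSuc (eSuc L)}"
    "{alt_len (\<lambda>x. fst x > 0) (\<lambda>x. snd x < 0) w, alt_len (\<lambda>x. snd x < 0) (\<lambda>x. fst x > 0) w} = {eSuc M, eSuc (eSuc M)}"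
    "{alt_len (\<lambda>x. fst x < 0) (\<lambda>x. snd x > 0) w, alt_len (\<lambda>x. snd x > 0) (\<lambda>x. fst x < 0) w} = {eSuc N, eSuc (eSuc N)}"
    using w unfolding alternation_profile_def by blast+
  have nums:
    "num_nonempty T1 T2 p q m n ({a. 1 * a > 0} \<times> {b. 1 * b > 0}) = 2 * K + 1"
    "num_nonempty T1 T2 p q m n ({a. -1 * a > 0} \<times> {b. -1 * b > 0}) = 2 * L + 1"
    "num_nonempty T1 T2 p q m n ({a. 1 * a > 0} \<times> {b. -1 * b > 0}) = 2 * M + 1"
    "num_nonempty T1 T2 p q m n ({a. -1 * a > 0} \<times> {b. 1 * b > 0}) = 2 * N + 1"
    by (rule num[OF _ _ _ _ lens(1)] num[OF _ _ _ _ lens(2)] num[OF _ _ _ _ lens(3)] num[OF _ _ _ _ lens(4)];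
        (simp; fail)?; unfold sign sgn; rule alt)+
  have sets: "{a::real. 1 * a > 0} = {0<..}" "{a::real. -1 * a > 0} = {..<0}" by auto
  have once: "\<exists>t\<in>{T1<..<T2}. P t" if "alternates P Q T1 T2 1" for P Q using that by auto
  have ge_one: "enat 1 \<le> x \<and> enat 1 \<le> y" if xy: "{x, y} = {eSuc k, eSuc (eSuc k)}" for x y k
  proof -
    have "enat 1 = eSuc 0" by (simp add: zero_enat_def eSuc_enat)
    then have "enat 1 \<le> eSuc i" for i by (simp only: eSuc_ile_mono zero_le)
    moreover have "x \<in> {eSuc k, eSuc (eSuc k)}" "y \<in> {eSuc k, eSuc (eSuc k)}" using xy by blast+
    ultimately show ?thesis by blast
  qed
  have "enat 1 \<le> alt_len (\<lambda>x. fst x > 0) (\<lambda>x. snd x > 0) w" "enat 1 \<le> alt_len (\<lambda>x. fst x < 0) (\<lambda>x. snd x < 0) w"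
    "enat 1 \<le> alt_len (\<lambda>x. snd x > 0) (\<lambda>x. fst x > 0) w" "enat 1 \<le> alt_len (\<lambda>x. snd x < 0) (\<lambda>x. fst x < 0) w"
    using ge_one[OF lens(1)] ge_one[OF lens(2)] by blast+
  then have "alternates (\<lambda>t. occurs (\<lambda>x. fst x > 0) w (s t)) (\<lambda>t. occurs (\<lambda>x. snd x > 0) w (s t)) T1 T2 1"
    "alternates (\<lambda>t. occurs (\<lambda>x. fst x < 0) w (s t)) (\<lambda>t. occurs (\<lambda>x. snd x < 0) w (s t)) T1 T2 1"
    "alternates (\<lambda>t. occurs (\<lambda>x. snd x > 0) w (s t)) (\<lambda>t. occurs (\<lambda>x. fst x > 0) w (s t)) T1 T2 1"
    "alternates (\<lambda>t. occurs (\<lambda>x. snd x < 0) w (s t)) (\<lambda>t. occurs (\<lambda>x. fst x < 0) w (s t)) T1 T2 1"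
    by (simp_all only: alt)
  from this[folded sgn, THEN once]
  have "\<exists>t\<in>{T1<..<T2}. m t > 0" "\<exists>t\<in>{T1<..<T2}. m t < 0"
    "\<exists>t\<in>{T1<..<T2}. n t > 0" "\<exists>t\<in>{T1<..<T2}. n t < 0" .
  moreover have pos: "max x 0 \<noteq> 0 \<longleftrightarrow> x > 0" "max (- x) 0 \<noteq> 0 \<longleftrightarrow> x < 0" for x :: real
    by (simp_all add: max_def)
  ultimately have "changes_sign T1 T2 m" "changes_sign T1 T2 n"
    unfolding changes_sign_def pos by simp_all
  with m n nums[unfolded sets] show ?thesis by blast
qed

end
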